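(* Let the number $n$ of agents be fixed. Given an allocation instance with $n$ agents and $m$ items in which all valuations $u_i(o)$ are positive integers and $u_i(O)\le V$ for every agent $i$, it is possible to compute an allocation that is utilitarian-maximal within EF1 in time $O(m^{n(n-1)+1}\cdot V^{n(n-1)})$ (in particular, in time $O(m^{n^2}V^{n^2})$).
   Context: An allocation instance is a tuple $(N,O,u)$ where $N=\{1,\dots,n\}$ is a set of agents, $O=\{o_1,\dots,o_m\}$ is a set of items, and $u_i(o)$ is agent $i$'s value for item $o$. Utilities are additive: $u_i(O')=\sum_{o\in O'}u_i(o)$ for every $O'\subseteq O$. An allocation is a function $p:N\to 2^O$ with $\bigcup_{i\in N}p(i)=O$ and $p(i)\cap p(j)=\emptyset$ for all $i\ne j$. An allocation $p$ is envy-free up to one item (EF1) if for all $i,j\in N$ there exists $O'\subseteq p(j)$ with $|O'|\le 1$ such that $u_i(p(i))\ge u_i(p(j)\setminus O')$. It is utilitarian-maximal within EF1 if it is EF1 and maximizes $\sum_{i\in N}u_i(q(i))$ over all EF1 allocations $q$. Time is measured in elementary operations (unit-cost arithmetic on the integers involved); $n$ is a constant, so the constant hidden in the $O$-notation may depend on $n$. *)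

theory Defs
  imports Main
begin

section \<open>Fair allocation\<close>

definition bundle_value :: "('i \<Rightarrow> 'o \<Rightarrow> 'v::linordered_semidom) \<Rightarrow> 'i \<Rightarrow> 'o set \<Rightarrow> 'v" where
  "bundle_value u i B = (\<Sum>x\<in>B. u i x)"

definition allocation :: "'i set \<Rightarrow> 'o set \<Rightarrow> ('i \<Rightarrow> 'o set) \<Rightarrow> bool" where
  "allocation Agents Items p \<longleftrightarrow>
     (\<Union>i\<in>Agents. p i) = Items \<and>
     (\<forall>i\<in>Agents. \<forall>j\<in>Agents. i \<noteq> j \<longrightarrow> p i \<inter> p j = {})"

definition EF1 :: "'i set \<Rightarrow> ('i \<Rightarrow> 'o \<Rightarrow> 'v::linordered_semidom) \<Rightarrow> ('i \<Rightarrow> 'o set) \<Rightarrow> bool" where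
  "EF1 Agents u p \<longleftrightarrow>
     (\<forall>i\<in>Agents. \<forall>j\<in>Agents. \<exists>R \<subseteq> p j. finite R \<and> card R \<le> 1 \<and>
        bundle_value u i (p i) \<ge> bundle_value u i (p j - R))"

definition utilitarian_welfare ::
  "'i set \<Rightarrow> ('i \<Rightarrow> 'o \<Rightarrow> 'v::linordered_semidom) \<Rightarrow> ('i \<Rightarrow> 'o set) \<Rightarrow> 'v" where
  "utilitarian_welfare Agents u p = (\<Sum>i\<in>Agents. bundle_value u i (p i))"

definition utilitarian_maximal_within_EF1 ::
  "'i set \<Rightarrow> 'o set \<Rightarrow> ('i \<Rightarrow> 'o \<Rightarrow> 'v::linordered_semidom) \<Rightarrow> ('i \<Rightarrow> 'o set) \<Rightarrow> bool" where
  "utilitarian_maximal_within_EF1 Agents Items u p \<longleftrightarrow>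
     allocation Agents Items p \<and> EF1 Agents u p \<and>
     (\<forall>q. allocation Agents Items q \<and> EF1 Agents u q \<longrightarrow>
          utilitarian_welfare Agents u q \<le> utilitarian_welfare Agents u p)"


section \<open>A unit-cost random access machine\<close>

text \<open>
  Programs are structured programs for a unit-cost random access machine over the integers.
  The memory consists of arrays indexed by integers; the array is selected by a natural number
  that is fixed in the program text, so each program uses finitely many arrays, while the index
  inside an array is computed at run time (indirect addressing).

  The arithmetic operations are addition and subtraction, as in the machine of Cook and Reckhow.
  Multiplication is left out on purpose: with unit-cost multiplication of unbounded integers a
  program could pack a whole table into one number and process it in a single step.  A time bound
  for this machine also holds for machines with a richer instruction set.
\<close>

type_synonym memory = "nat \<Rightarrow> int \<Rightarrow> int"

datatype expr =
    Const int
  | Cell nat expr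
  | Plus expr expr
  | Minus expr expr

datatype test =
    Less expr expr
  | Neg test
  | Conj test test

datatype prog =
    Skip
  | Store nat expr expr   \<comment> \<open>\<open>Store a e e'\<close> writes the value of \<open>e'\<close> to index \<open>e\<close> of array \<open>a\<close>\<close>
  | Seq prog prog
  | Cond test prog prog
  | While test prog

fun eval_expr :: "expr \<Rightarrow> memory \<Rightarrow> int" where
  "eval_expr (Const k) s = k"
| "eval_expr (Cell a e) s = s a (eval_expr e s)"
| "eval_expr (Plus e e') s = eval_expr e s + eval_expr e' s"
| "eval_expr (Minus e e') s = eval_expr e s - eval_expr e' s"

fun eval_test :: "test \<Rightarrow> memory \<Rightarrow> bool" where
  "eval_test (Less e e') s \<longleftrightarrow> eval_expr e s < eval_expr e' s"
| "eval_test (Neg b) s \<longleftrightarrow> \<not> eval_test b s"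
| "eval_test (Conj b b') s \<longleftrightarrow> eval_test b s \<and> eval_test b' s"

text \<open>Every constant, memory access, arithmetic operation, comparison and Boolean connective
  costs one step.\<close>

fun expr_cost :: "expr \<Rightarrow> nat" where
  "expr_cost (Const k) = 1"
| "expr_cost (Cell a e) = expr_cost e + 1"
| "expr_cost (Plus e e') = expr_cost e + expr_cost e' + 1"
| "expr_cost (Minus e e') = expr_cost e + expr_cost e' + 1"

fun test_cost :: "test \<Rightarrow> nat" where
  "test_cost (Less e e') = expr_cost e + expr_cost e' + 1"
| "test_cost (Neg b) = test_cost b + 1"
| "test_cost (Conj b b') = test_cost b + test_cost b' + 1"

text \<open>\<open>exec c s t s'\<close>: started in memory \<open>s\<close>, program \<open>c\<close> halts after exactly \<open>t\<close> steps
  with memory \<open>s'\<close>.\<close>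

inductive exec :: "prog \<Rightarrow> memory \<Rightarrow> nat \<Rightarrow> memory \<Rightarrow> bool" where
  Skip: "exec Skip s 1 s"
| Store: "exec (Store a e e') s (expr_cost e + expr_cost e' + 1)
            (s(a := (s a)(eval_expr e s := eval_expr e' s)))"
| Seq: "exec c s t s' \<Longrightarrow> exec c' s' t' s'' \<Longrightarrow> exec (Seq c c') s (t + t') s''"
| CondTrue: "eval_test b s \<Longrightarrow> exec c s t s' \<Longrightarrow> exec (Cond b c c') s (test_cost b + 1 + t) s'"
| CondFalse: "\<not> eval_test b s \<Longrightarrow> exec c' s t s' \<Longrightarrow> exec (Cond b c c') s (test_cost b + 1 + t) s'"
| WhileFalse: "\<not> eval_test b s \<Longrightarrow> exec (While b c) s (test_cost b + 1) s"
| WhileTrue: "eval_test b s \<Longrightarrow> exec c s t s' \<Longrightarrow> exec (While b c) s' t' s'' \<Longrightarrow>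
    exec (While b c) s (test_cost b + 1 + t + t') s''"

inductive_cases exec_SkipE: "exec Skip s t s'"
inductive_cases exec_StoreE: "exec (Store a e e') s t s'"
inductive_cases exec_SeqE: "exec (Seq c c') s t s'"
inductive_cases exec_CondE: "exec (Cond b c c') s t s'"
inductive_cases exec_WhileE: "exec (While b c) s t s'"

lemma exec_deterministic:
  "exec c s t s' \<Longrightarrow> exec c s r r' \<Longrightarrow> r = t \<and> r' = s'"
proof (induction arbitrary: r r' rule: exec.induct)
  case (Skip s)
  from Skip.prems show ?case by (rule exec_SkipE) simp
next
  case (Store a e e' s)
  from Store.prems show ?case by (rule exec_StoreE) simp
next
  case (Seq c s t s' c' t' s'')
  from Seq.prems obtain t1 s1 t2 where "exec c s t1 s1" "exec c' s1 t2 r'" "r = t1 + t2"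
    by (rule exec_SeqE)
  with Seq.IH show ?case by simp
next
  case (CondTrue b s c t s' c')
  from CondTrue.prems obtain t1 where "exec c s t1 r'" "r = test_cost b + 1 + t1"
    by (rule exec_CondE) (use CondTrue.hyps(1) in simp_all)
  with CondTrue.IH show ?case by simp
next
  case (CondFalse b s c' t s' c)
  from CondFalse.prems obtain t1 where "exec c' s t1 r'" "r = test_cost b + 1 + t1"
    by (rule exec_CondE) (use CondFalse.hyps(1) in simp_all)
  with CondFalse.IH show ?case by simp
next
  case (WhileFalse b s c)
  from WhileFalse.prems show ?case by (rule exec_WhileE) (use WhileFalse.hyps(1) in simp_all)
next
  case (WhileTrue b s c t s' t' s'')
  from WhileTrue.prems obtain t1 s1 t2
    where "exec c s t1 s1" "exec (While b c) s1 t2 r'" "r = test_cost b + 1 + t1 + t2"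
    by (rule exec_WhileE) (use WhileTrue.hyps(1) in simp_all)
  with WhileTrue.IH show ?case by simp
qed


section \<open>Encoding of instances and allocations\<close>

text \<open>
  For agents \<open>{1..n}\<close> and items \<open>{1..m}\<close>, the input stores \<open>m\<close> at index 0 of array 0 and the value
  of item \<open>k\<close> for agent \<open>i\<close> at index \<open>k\<close> of array \<open>i\<close>; everything else is 0.  In particular no upper
  bound on the values is given to the program.  The output stores at index \<open>k\<close> of array 0 the
  agent that receives item \<open>k\<close>.
\<close>

definition input_memory :: "nat \<Rightarrow> nat \<Rightarrow> (nat \<Rightarrow> nat \<Rightarrow> nat) \<Rightarrow> memory" where
  "input_memory n m u = (\<lambda>a k.
     if a = 0 \<and> k = 0 then int m
     else if 1 \<le> a \<and> a \<le> n \<and> 1 \<le> k \<and> k \<le> int m then int (u a (nat k))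
     else 0)"

definition output_allocation :: "nat \<Rightarrow> memory \<Rightarrow> nat \<Rightarrow> nat set" where
  "output_allocation m s i = {k \<in> {1..m}. s 0 (int k) = int i}"

end

theory Submission
  imports Defs
begin

text \<open>
  The algorithm is a dynamic program over a single integer.  Every item is given to an agent and is
  marked for some of the \<open>d = n * (n - 1)\<close> ordered pairs \<open>(i, j)\<close>; a mark for \<open>(i, j)\<close> means that \<open>i\<close>
  disregards the item when looking at the bundle of \<open>j\<close>.  An allocation is EF1 iff it extends to
  choices with exactly one mark for each pair (an item outside \<open>j\<close>'s bundle may be marked) and no
  remaining envy.  For each pair, \<open>L\<close> times the number of marks plus the remaining difference is a
  digit with fewer than \<open>Q = (m + 1) * L = O(m * V)\<close> possible values, where \<open>L = 2 * W + 1\<close> and \<open>W\<close> is the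
  total value over all agents and items.  The \<open>d\<close> digits form one number in base \<open>Q\<close>, each choice adds
  a fixed weight to it, and so the maximal welfare is found by a knapsack recursion with \<open>m\<close> rows of
  \<open>O((m * V) ^ d)\<close> entries.  The entries of all rows are kept, at addresses far enough apart, and back
  pointers recover the allocation.
\<close>

section \<open>Cost bounds for programs\<close>

text \<open>The machine has no division, so a digit cannot be read back from a number, and the
  program never decodes a state. This fixes the direction of the recursion. A state in row
  \<open>k\<close> is the number accumulated from the items after \<open>k\<close>, and row 0 is the
  set of accepting numbers itself, written down by \<open>d\<close> nested loops over digit values
  instead of being tested. The optimum is then the single entry for 0 in row \<open>m\<close>.
  Products are repeated additions whose loop count is \<open>L\<close>, \<open>m + 1\<close> or an
  item value.

  Partial sums can have negative digits. Uniqueness of the digits needs only differences below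
  \<open>Q\<close>, so no offset is added, and a row is a window around 0. Entries hold 1 plus a
  welfare: untouched memory is 0 and hence already means infeasible, which spares initialisation and
  range checks.

  The program is not told \<open>V\<close>. It computes \<open>W\<close>, which bounds every bundle
  value and is at most \<open>n * V\<close>. Existence of an EF1 allocation enters because it makes
  the entry for 0 positive, and only a positive entry has a back pointer to follow.\<close>

definition run :: "prog \<Rightarrow> memory \<Rightarrow> nat \<Rightarrow> (memory \<Rightarrow> bool) \<Rightarrow> bool" where
  "run c s T R \<longleftrightarrow> (\<exists>t s'. exec c s t s' \<and> t \<le> T \<and> R s')"

lemma run_mono:
  assumes "run c s T R" and "T \<le> T'" and "\<And>s'. R s' \<Longrightarrow> R' s'"
  shows "run c s T' R'"
  using assms unfolding run_def by (meson le_trans)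

lemma run_Seq:
  assumes "run c s T1 R1" and "\<And>s'. R1 s' \<Longrightarrow> run c' s' T2 R" and "T1 + T2 \<le> T"
  shows "run (Seq c c') s T R"
proof -
  obtain t1 s1 where 1: "exec c s t1 s1" "t1 \<le> T1" "R1 s1"
    using assms(1) by (auto simp: run_def)
  obtain t2 s2 where 2: "exec c' s1 t2 s2" "t2 \<le> T2" "R s2"
    using assms(2)[OF 1(3)] by (auto simp: run_def)
  have "exec (Seq c c') s (t1 + t2) s2"
    using 1 2 by (blast intro: exec.Seq)
  then show ?thesis
    using 1 2 assms(3) unfolding run_def by (meson add_mono le_trans)
qed

text \<open>The invariant is indexed by the iteration number, so it also serves as the variant: the
  test must hold before iteration \<open>N\<close> and fail there. The induction is on
  \<open>N - i\<close>, and the last summand of the cost pays for the failing test.\<close>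

lemma run_While:
  assumes init: "I 0 s"
    and step: "\<And>i s. i < N \<Longrightarrow> I i s \<Longrightarrow> eval_test b s \<and> run c s B (I (Suc i))"
    and exit: "\<And>s. I N s \<Longrightarrow> \<not> eval_test b s \<and> R s"
    and cost: "N * (test_cost b + 1 + B) + test_cost b + 1 \<le> T"
  shows "run (While b c) s T R"
proof -
  have "run (While b c) s ((N - i) * (test_cost b + 1 + B) + test_cost b + 1) R"
    if "i \<le> N" "I i s" for i s
    using that
  proof (induction "N - i" arbitrary: i s)
    case 0
    then have "i = N" by simp
    with 0 exit have "exec (While b c) s (test_cost b + 1) s" "R s"
      by (blast intro: exec.WhileFalse)+
    then show ?case using \<open>i = N\<close> by (auto simp: run_def)
  next
    case (Suc k)
    then have lt: "i < N" by simp
    then obtain t1 s1 where 1: "exec c s t1 s1" "t1 \<le> B" "I (Suc i) s1" and b: "eval_test b s"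
      using step[OF lt Suc.prems(2)] by (auto simp: run_def)
    have "run (While b c) s1 ((N - Suc i) * (test_cost b + 1 + B) + test_cost b + 1) R"
      by (rule Suc.hyps(1)) (use Suc.hyps(2) lt 1(3) in auto)
    then obtain t2 s2 where 2: "exec (While b c) s1 t2 s2"
      "t2 \<le> (N - Suc i) * (test_cost b + 1 + B) + test_cost b + 1" "R s2"
      unfolding run_def by blast
    have "exec (While b c) s (test_cost b + 1 + t1 + t2) s2"
      using b 1 2 by (blast intro: exec.WhileTrue)
    moreover have "N - i = Suc (N - Suc i)" using lt by simp
    ultimately show ?case
      unfolding run_def using 1 2
      by (intro exI[of _ "test_cost b + 1 + t1 + t2"] exI[of _ s2]) simp
  qed
  from this[OF le0 init] show ?thesis
    by (rule run_mono) (use cost in auto)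
qed

section \<open>Straight-line programs and loops unrolled in the program text\<close>

fun loop_free :: "prog \<Rightarrow> bool" where
  "loop_free Skip \<longleftrightarrow> True"
| "loop_free (Store a e e') \<longleftrightarrow> True"
| "loop_free (Seq c c') \<longleftrightarrow> loop_free c \<and> loop_free c'"
| "loop_free (Cond b c c') \<longleftrightarrow> loop_free c \<and> loop_free c'"
| "loop_free (While b c) \<longleftrightarrow> False"

text \<open>Lets the simplifier execute loop-free code. The clause for \<open>While\<close> is a
  dummy value that \<open>loop_free\<close> excludes.\<close>

fun result :: "prog \<Rightarrow> memory \<Rightarrow> memory" where
  "result Skip s = s"
| "result (Store a e e') s = s(a := (s a)(eval_expr e s := eval_expr e' s))"
| "result (Seq c c') s = result c' (result c s)"
| "result (Cond b c c') s = (if eval_test b s then result c s else result c' s)"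
| "result (While b c) s = s"

text \<open>A conditional is charged for both branches, which keeps the bound a plain sum that does
  not depend on the memory.\<close>

fun cost_bound :: "prog \<Rightarrow> nat" where
  "cost_bound Skip = 1"
| "cost_bound (Store a e e') = expr_cost e + expr_cost e' + 1"
| "cost_bound (Seq c c') = cost_bound c + cost_bound c'"
| "cost_bound (Cond b c c') = test_cost b + 1 + (cost_bound c + cost_bound c')"
| "cost_bound (While b c) = 0"

lemma exec_loop_free: "loop_free c \<Longrightarrow> \<exists>t \<le> cost_bound c. exec c s t (result c s)"
proof (induction c arbitrary: s)
  case Skip
  show ?case using exec.Skip by auto
next
  case (Store a e e')
  show ?case
    using exec.Store[of a e e' s] unfolding result.simps cost_bound.simps by blast
next
  case (Seq c1 c2)
  obtain t1 where 1: "t1 \<le> cost_bound c1" "exec c1 s t1 (result c1 s)"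
    using Seq by auto
  obtain t2 where 2: "t2 \<le> cost_bound c2" "exec c2 (result c1 s) t2 (result c2 (result c1 s))"
    using Seq by auto
  have "exec (Seq c1 c2) s (t1 + t2) (result (Seq c1 c2) s)"
    using exec.Seq 1 2 by simp
  then show ?case using 1 2 by (intro exI[of _ "t1 + t2"]) simp
next
  case (Cond b c1 c2)
  show ?case
  proof (cases "eval_test b s")
    case True
    obtain t1 where 1: "t1 \<le> cost_bound c1" "exec c1 s t1 (result c1 s)"
      using Cond by auto
    have "exec (Cond b c1 c2) s (test_cost b + 1 + t1) (result (Cond b c1 c2) s)"
      using exec.CondTrue 1 True by simp
    then show ?thesis using 1 by (intro exI[of _ "test_cost b + 1 + t1"]) simp
  next
    case False
    obtain t1 where 1: "t1 \<le> cost_bound c2" "exec c2 s t1 (result c2 s)"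
      using Cond by auto
    have "exec (Cond b c1 c2) s (test_cost b + 1 + t1) (result (Cond b c1 c2) s)"
      using exec.CondFalse 1 False by simp
    then show ?thesis using 1 by (intro exI[of _ "test_cost b + 1 + t1"]) simp
  qed
next
  case (While b c)
  then show ?case by simp
qed

lemma run_loop_free:
  assumes "loop_free c" and "R (result c s)" and "cost_bound c \<le> T"
  shows "run c s T R"
  using exec_loop_free[OF assms(1), of s] assms(2,3) le_trans unfolding run_def by meson

definition seqs :: "prog list \<Rightarrow> prog" where
  "seqs cs = foldr Seq cs Skip"

lemma seqs_simps [simp]: "seqs [] = Skip" "seqs (c # cs) = Seq c (seqs cs)"
  by (simp_all add: seqs_def)

lemma loop_free_seqs [simp]: "loop_free (seqs cs) \<longleftrightarrow> (\<forall>c\<in>set cs. loop_free c)"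
  by (induction cs) auto

lemma run_seqs_upt:
  assumes "I a s" and "a \<le> b"
    and "\<And>i s. a \<le> i \<Longrightarrow> i < b \<Longrightarrow> I i s \<Longrightarrow> run (f i) s B (I (Suc i))"
    and "\<And>s. I b s \<Longrightarrow> R s" and "(b - a) * B + 1 \<le> T"
  shows "run (seqs (map f [a..<b])) s T R"
  using assms
proof (induction "b - a" arbitrary: a s T)
  case 0
  then have "R s" by simp
  then show ?case using 0 by (auto intro!: run_loop_free)
next
  case (Suc k)
  then have lt: "a < b" and k: "k = b - Suc a" by auto
  have "run (Seq (f a) (seqs (map f [Suc a..<b]))) s T R"
  proof (rule run_Seq[where ?T1.0 = B and ?T2.0 = "(b - Suc a) * B + 1"])
    show "run (f a) s B (I (Suc a))" using Suc lt by auto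
    show "run (seqs (map f [Suc a..<b])) s' ((b - Suc a) * B + 1) R" if "I (Suc a) s'" for s'
      by (rule Suc.hyps(1)) (use Suc k lt that in auto)
    have "b - a = Suc (b - Suc a)" using lt by simp
    then show "B + ((b - Suc a) * B + 1) \<le> T"
      using Suc.prems(5) by simp
  qed
  then show ?case using lt by (simp add: upt_conv_Cons)
qed

definition expr_sum :: "expr list \<Rightarrow> expr" where
  "expr_sum es = foldr Plus es (Const 0)"

lemma eval_expr_sum [simp]: "eval_expr (expr_sum es) s = (\<Sum>e\<leftarrow>es. eval_expr e s)"
  by (induction es) (auto simp: expr_sum_def)

text \<open>Multiplication by repeated addition. The number of steps grows with the value of
  \<open>e\<close> but not with that of \<open>e'\<close>, so the factor of moderate size is always
  \<open>e\<close>, and the multiple of a power of \<open>Q\<close> is \<open>e'\<close>.\<close>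

definition product_prog :: "nat \<Rightarrow> nat \<Rightarrow> expr \<Rightarrow> expr \<Rightarrow> prog" where
  "product_prog a r e e' =
     Seq (Store a (Const 0) (Const 0)) (Seq (Store r (Const 0) (Const 0))
       (While (Less (Cell a (Const 0)) e)
         (Seq (Store r (Const 0) (Plus (Cell r (Const 0)) e'))
              (Store a (Const 0) (Plus (Cell a (Const 0)) (Const 1))))))"

text \<open>The loop overwrites its counter and its accumulator, so both factors must keep their
  values whatever index 0 of those two arrays holds.\<close>

lemma run_product_prog:
  assumes "a \<noteq> r"
    and e: "\<And>v v'. eval_expr e (s(a := (s a)(0 := v), r := (s r)(0 := v'))) = int N"
    and e': "\<And>v v'. eval_expr e' (s(a := (s a)(0 := v), r := (s r)(0 := v'))) = y"
    and T: "(N + 1) * (expr_cost e + expr_cost e' + 20) \<le> T"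
  shows "run (product_prog a r e e') s T
    (\<lambda>s'. s' = s(a := (s a)(0 := int N), r := (s r)(0 := int N * y)))"
proof -
  let ?s = "\<lambda>i. s(a := (s a)(0 := int i), r := (s r)(0 := int i * y))"
  let ?body = "Seq (Store r (Const 0) (Plus (Cell r (Const 0)) e'))
              (Store a (Const 0) (Plus (Cell a (Const 0)) (Const 1)))"
  have s0: "s(a := (s a)(0 := 0), r := (s r)(0 := 0)) = ?s 0" by simp
  have loop: "run (While (Less (Cell a (Const 0)) e) ?body) (?s 0)
     (N * (expr_cost e + expr_cost e' + 15) + expr_cost e + 4) (\<lambda>s'. s' = ?s N)"
  proof (rule run_While[where I = "\<lambda>i s'. s' = ?s i" and N = N and B = "expr_cost e' + 11"])
    fix i s' assume i: "i < N" and s': "s' = ?s i"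
    have *: "eval_expr e s' = int N" "eval_expr e' s' = y"
      unfolding s' by (rule e e')+
    have res: "result ?body s' = ?s (Suc i)"
      using assms(1) * unfolding s' by (auto simp: fun_eq_iff algebra_simps)
    have "run ?body s' (expr_cost e' + 11) (\<lambda>s'. s' = ?s (Suc i))"
      by (rule run_loop_free, simp, rule res, simp)
    then show "eval_test (Less (Cell a (Const 0)) e) s' \<and>
        run ?body s' (expr_cost e' + 11) (\<lambda>s'. s' = ?s (Suc i))"
      using i *(1) s' assms(1) by simp
  qed (use e[of "int N" "int N * y"] assms(1) in \<open>auto simp: algebra_simps\<close>)
  show ?thesis
    unfolding product_prog_def
    apply (rule run_Seq[OF run_loop_free[where T = 3
          and R = "\<lambda>s'. s' = s(a := (s a)(0 := 0))"]])
       apply (simp_all only: loop_free.simps result.simps cost_bound.simps expr_cost.simps eval_expr.simps)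
     apply (rule run_Seq[OF run_loop_free[where T = 3
          and R = "\<lambda>s'. s' = ?s 0"]])
        apply (use assms(1) in \<open>simp_all add: fun_eq_iff\<close>)[3]
      apply (simp only:)
      apply (rule loop)
     apply (rule order.refl)
    using T by (simp add: algebra_simps)
qed

section \<open>Existence of EF1 allocations\<close>

lemma bundle_value_mono:
  assumes "finite B" "A \<subseteq> B"
  shows "bundle_value (u :: 'i \<Rightarrow> 'o \<Rightarrow> nat) i A \<le> bundle_value u i B"
  unfolding bundle_value_def by (rule sum_mono2) (use assms in auto)

definition envies_up_to_one :: "('i \<Rightarrow> 'o \<Rightarrow> nat) \<Rightarrow> ('i \<Rightarrow> 'o set) \<Rightarrow> 'i \<Rightarrow> 'i \<Rightarrow> bool" where
  "envies_up_to_one u p i j \<longleftrightarrow>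
     (\<exists>R \<subseteq> p j. finite R \<and> card R \<le> 1 \<and> bundle_value u i (p j - R) \<le> bundle_value u i (p i))"

text \<open>Round robin: the first agent takes a favourite item and becomes the last one
  in the order for the remaining items.\<close>

lemma round_robin:
  fixes u :: "'i \<Rightarrow> 'o \<Rightarrow> nat"
  assumes "finite A" and "distinct xs" and "xs \<noteq> []"
  shows "\<exists>p. allocation (set xs) A p \<and>
     sorted_wrt (\<lambda>i j. bundle_value u i (p j) \<le> bundle_value u i (p i)) xs \<and>
     (\<forall>i\<in>set xs. \<forall>j\<in>set xs. envies_up_to_one u p i j)"
  using assms
proof (induction "card A" arbitrary: A xs)
  case 0
  then have "A = {}" by simp
  have "sorted_wrt (\<lambda>i j. True) xs" by (induction xs) auto
  then show ?case
    by (intro exI[of _ "\<lambda>_. {}"])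
      (auto simp: \<open>A = {}\<close> allocation_def envies_up_to_one_def bundle_value_def)
next
  case (Suc l)
  then obtain x ys where xs: "xs = x # ys" by (cases xs) auto
  have fin: "finite A" and ne: "A \<noteq> {}" using Suc by auto
  have "Max (u x ` A) \<in> u x ` A" using fin ne by simp
  then obtain o1 where o1: "o1 \<in> A" "\<And>a. a \<in> A \<Longrightarrow> u x a \<le> u x o1"
    using fin by (metis (no_types, lifting) Max_ge finite_imageI imageE imageI)
  \<comment> \<open>\<open>x\<close> moves to the end of the order. Sortedness in the claim says
    that nobody envies a later agent, so with respect to the remaining items nobody envies
    \<open>x\<close>.\<close>
  let ?xs = "ys @ [x]"
  have sxs: "set ?xs = set xs" and x_ys: "x \<notin> set ys" using Suc xs by auto
  have "l = card (A - {o1})" using Suc.hyps(2) o1(1) fin by simp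
  moreover have "finite (A - {o1})" "distinct ?xs" "?xs \<noteq> []"
    using fin Suc.prems(2) xs by auto
  ultimately obtain p where
    al: "allocation (set xs) (A - {o1}) p" and
    so: "sorted_wrt (\<lambda>i j. bundle_value u i (p j) \<le> bundle_value u i (p i)) ?xs" and
    ef: "\<And>i j. i \<in> set xs \<Longrightarrow> j \<in> set xs \<Longrightarrow> envies_up_to_one u p i j"
    using Suc.hyps(1)[of "A - {o1}" ?xs] unfolding sxs by blast
  define q where "q = p(x := insert o1 (p x))"
  have pA: "p i \<subseteq> A - {o1}" if "i \<in> set xs" for i
    using al that unfolding allocation_def by blast
  have fp: "finite (p i)" if "i \<in> set xs" for i
    using pA[OF that] fin by (meson finite_Diff finite_subset)
  have xin: "x \<in> set xs" using xs by simp
  have q_x: "bundle_value u i (q x) = u i o1 + bundle_value u i (p x)" for i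
    unfolding q_def bundle_value_def using pA[OF xin] fp[OF xin] by (subst fun_upd_same, subst sum.insert) auto
  have q_o: "q j = p j" if "j \<noteq> x" for j using that by (simp add: q_def)
  have "allocation (set xs) A q"
  proof -
    have U: "(\<Union>i\<in>set xs. p i) = A - {o1}" and D: "\<And>i j. i \<in> set xs \<Longrightarrow> j \<in> set xs \<Longrightarrow> i \<noteq> j \<Longrightarrow> p i \<inter> p j = {}"
      using al unfolding allocation_def by auto
    have "(\<Union>i\<in>set xs. q i) = insert o1 (\<Union>i\<in>set xs. p i)"
      using xin by (auto simp: q_def split: if_splits)
    then have "(\<Union>i\<in>set xs. q i) = A" using U o1(1) by auto
    moreover have "q i \<inter> q j = {}" if "i \<in> set xs" "j \<in> set xs" "i \<noteq> j" for i j
      using D[OF that] pA[OF that(1)] pA[OF that(2)] that(3) by (auto simp: q_def)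
    ultimately show ?thesis by (auto simp: allocation_def)
  qed
  moreover have x_best: "bundle_value u x (q j) \<le> bundle_value u x (q x)" if j: "j \<in> set ys" for j
  proof -
    have jx: "j \<noteq> x" "j \<in> set xs" using j x_ys xs by auto
    obtain R where R: "R \<subseteq> p j" "card R \<le> 1" "finite R"
      "bundle_value u x (p j - R) \<le> bundle_value u x (p x)"
      using ef[OF xin jx(2)] unfolding envies_up_to_one_def by blast
    \<comment> \<open>What \<open>x\<close> disregards in the bundle of \<open>j\<close> is at most
      one item, and it was available when \<open>x\<close> took the favourite \<open>o1\<close>; so
      \<open>o1\<close> makes up for it.\<close>
    have "sum (u x) R \<le> of_nat (card R) * u x o1"
      by (rule sum_bounded_above) (use R pA[OF jx(2)] o1 in auto)
    also have "\<dots> \<le> u x o1" using R(2) by simp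
    finally have "sum (u x) R \<le> u x o1" .
    moreover have "bundle_value u x (p j) = bundle_value u x (p j - R) + sum (u x) R"
      unfolding bundle_value_def by (rule sum.subset_diff) (use R fp jx in auto)
    ultimately show ?thesis using R q_x q_o[OF jx(1)] by simp
  qed
  moreover have "sorted_wrt (\<lambda>i j. bundle_value u i (q j) \<le> bundle_value u i (q i)) ys"
  proof (rule sorted_wrt_mono_rel[rotated])
    show "sorted_wrt (\<lambda>i j. bundle_value u i (p j) \<le> bundle_value u i (p i)) ys"
      using so by (simp add: sorted_wrt_append)
  qed (use x_ys q_o in metis)
  moreover have "envies_up_to_one u q i j" if ij: "i \<in> set xs" "j \<in> set xs" for i j
  proof (cases "i = x")
    case True
    then have "bundle_value u i (q j) \<le> bundle_value u i (q i)"
      using x_best ij xs by auto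
    then show ?thesis unfolding envies_up_to_one_def by (intro exI[of _ "{}"]) simp
  next
    case False
    show ?thesis
    proof (cases "j = x")
      case True
      \<comment> \<open>Disregarding \<open>o1\<close> turns the bundle of \<open>x\<close> back
        into \<open>p x\<close>, which \<open>i\<close> does not envy because \<open>x\<close> is
        last in \<open>?xs\<close>.\<close>
      have "bundle_value u i (p x) \<le> bundle_value u i (p i)"
        using so False ij xs by (auto simp: sorted_wrt_append)
      moreover have "q x - {o1} = p x" using pA[OF xin] by (auto simp: q_def)
      ultimately show ?thesis
        unfolding envies_up_to_one_def using True q_o[OF False]
        by (intro exI[of _ "{o1}"]) (auto simp: q_def)
    next
      case j: False
      then show ?thesis using ef[OF ij] q_o[OF False] q_o[OF j] by (simp add: envies_up_to_one_def)
    qed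
  qed
  ultimately show ?case using xs by (intro exI[of _ q]) auto
qed

corollary EF1_allocation_exists:
  fixes u :: "nat \<Rightarrow> 'o \<Rightarrow> nat"
  assumes "finite A" and "n \<ge> 1"
  shows "\<exists>p. allocation {1..n} A p \<and> EF1 {1..n} u p"
proof -
  have s: "set [1..<Suc n] = {1..n}" by auto
  obtain p where p: "allocation {1..n} A p" "\<forall>i\<in>{1..n}. \<forall>j\<in>{1..n}. envies_up_to_one u p i j"
    using round_robin[OF assms(1), of "[1..<Suc n]" u] assms(2) unfolding s by auto
  then show ?thesis
    unfolding EF1_def envies_up_to_one_def by blast
qed

section \<open>The recursion\<close>

text \<open>Signed digits are allowed; only differences are bounded. The difference \<open>c\<close>
  of the two sequences sums to 0, so \<open>q\<close> divides \<open>c 0\<close>, and a multiple of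
  \<open>q\<close> of absolute value below \<open>q\<close> is 0. Then \<open>q\<close> is cancelled
  and the other digits shift down.\<close>

lemma digits_unique:
  fixes a b :: "nat \<Rightarrow> int"
  assumes "\<And>e. e < d \<Longrightarrow> \<bar>a e - b e\<bar> < q"
    and "(\<Sum>e<d. q ^ e * a e) = (\<Sum>e<d. q ^ e * b e)" and "e < d"
  shows "a e = b e"
proof -
  have "c e = 0" if "\<And>e. e < d \<Longrightarrow> \<bar>c e\<bar> < q" "(\<Sum>e<d. q ^ e * c e) = 0" "e < d"
    for c :: "nat \<Rightarrow> int" and e
    using that
  proof (induction d arbitrary: c e)
    case 0
    then show ?case by simp
  next
    case (Suc d)
    have s: "c 0 + q * (\<Sum>e<d. q ^ e * c (Suc e)) = 0"
      using Suc.prems(2)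
      by (simp add: sum.lessThan_Suc_shift sum_distrib_left mult.assoc del: sum.lessThan_Suc)
    then have "c 0 = q * - (\<Sum>e<d. q ^ e * c (Suc e))" by simp
    then have "q dvd c 0" by (rule dvdI)
    then have c0: "c 0 = 0"
      using Suc.prems(1)[of 0] zdvd_not_zless[of "\<bar>c 0\<bar>" q] by (cases "c 0 = 0") auto
    have "q \<noteq> 0" using Suc.prems(1)[of 0] by auto
    then have z: "(\<Sum>e<d. q ^ e * c (Suc e)) = 0" using s c0 by simp
    have "c (Suc e) = 0" if "e < d" for e
      by (rule Suc.IH[OF _ z that], rule Suc.prems(1), simp)
    then show ?case using c0 Suc.prems(3) by (cases e) auto
  qed
  from this[of "\<lambda>e. a e - b e"] show ?thesis
    using assms by (simp add: right_diff_distrib sum_subtractf)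
qed

lemma digits_bound:
  fixes a :: "nat \<Rightarrow> int"
  assumes "\<And>e. e < d \<Longrightarrow> \<bar>a e\<bar> < q" and "1 \<le> q"
  shows "\<bar>\<Sum>e<d. q ^ e * a e\<bar> < q ^ d"
  using assms(1)
proof (induction d)
  case 0
  then show ?case by simp
next
  case (Suc d)
  have "\<bar>q ^ d * a d\<bar> \<le> q ^ d * (q - 1)"
    using Suc.prems[of d] assms(2) by (auto simp: abs_mult intro!: mult_left_mono)
  moreover have "\<bar>\<Sum>e<d. q ^ e * a e\<bar> < q ^ d" using Suc by simp
  ultimately show ?case by (auto simp: algebra_simps abs_if split: if_splits)
qed

definition pairs :: "nat \<Rightarrow> (nat \<times> nat) list" where
  "pairs n = filter (\<lambda>(i, j). i \<noteq> j) (List.product [1..<Suc n] [1..<Suc n])"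

lemma set_pairs: "set (pairs n) = {(i, j). i \<in> {1..n} \<and> j \<in> {1..n} \<and> i \<noteq> j}"
  by (auto simp: pairs_def)

lemma length_pairs: "length (pairs n) = n * (n - 1)"
proof -
  have "length (pairs n) = card (set (pairs n))"
    by (rule distinct_card[symmetric]) (simp add: pairs_def distinct_product)
  also have "set (pairs n) = {1..n} \<times> {1..n} - (\<lambda>i. (i, i)) ` {1..n}"
    unfolding set_pairs by auto
  also have "card \<dots> = n * n - n"
    by (subst card_Diff_subset) (auto simp: card_image inj_on_def)
  finally show ?thesis by (simp add: diff_mult_distrib2)
qed

text \<open>A choice for an item consists of the agent \<open>j\<close> receiving it and the list of (indices of)
  pairs \<open>(i, i')\<close> for which it is the item that \<open>i\<close> disregards in the bundle of \<open>i'\<close>.\<close>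

type_synonym choice = "nat \<times> nat list"

text \<open>There are \<open>n * 2 ^ d\<close> choices with \<open>d = length (pairs n)\<close>, a
  number depending on \<open>n\<close> only. Hence the loop over choices can be unrolled, and one
  table entry costs a constant.\<close>

definition choices :: "nat \<Rightarrow> choice list" where
  "choices n = List.product [1..<Suc n] (subseqs [0..<length (pairs n)])"

lemma choices_agent: "c \<in> set (choices n) \<Longrightarrow> fst c \<in> {1..n}"
  by (auto simp: choices_def)

lemma choices_ex:
  assumes "j \<in> {1..n}"
  shows "\<exists>c\<in>set (choices n). fst c = j \<and> (\<forall>e<length (pairs n). e \<in> set (snd c) \<longleftrightarrow> P e)"
proof -
  have "{e. e < length (pairs n) \<and> P e} \<in> set ` set (subseqs [0..<length (pairs n)])"
    unfolding subseqs_powset by auto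
  then obtain M where M: "{e. e < length (pairs n) \<and> P e} = set M"
    "M \<in> set (subseqs [0..<length (pairs n)])" by (rule imageE)
  have "(j, M) \<in> set (choices n)"
    using assms M(2) unfolding choices_def set_product by auto
  then show ?thesis using M(1)[symmetric] by (intro bexI[of _ "(j, M)"]) simp_all
qed

text \<open>Update of an entry by one choice: \<open>r\<close> is the entry of the state that the
  choice leads to, and \<open>0 < r\<close> rejects infeasible states. A tie keeps the older back
  pointer.\<close>

definition better :: "int \<Rightarrow> int \<Rightarrow> int \<Rightarrow> int \<Rightarrow> int \<times> int \<times> int \<Rightarrow> int \<times> int \<times> int" where
  "better r g j y p = (if 0 < r \<and> fst p < r + g then (r + g, j, y) else p)"

lemma foldl_better_ge:
  fixes r g j y :: "'c \<Rightarrow> int"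
  defines "F \<equiv> \<lambda>p c. better (r c) (g c) (j c) (y c) p"
  shows "fst p \<le> fst (foldl F p cs)"
    and "c \<in> set cs \<Longrightarrow> 0 < r c \<Longrightarrow> r c + g c \<le> fst (foldl F p cs)"
proof -
  have 1: "fst p \<le> fst (F p c)" "0 < r c \<Longrightarrow> r c + g c \<le> fst (F p c)" for p c
    by (auto simp: F_def better_def)
  show 2: "fst p \<le> fst (foldl F p cs)" for p cs
  proof (induction cs arbitrary: p)
    case (Cons c cs)
    show ?case using order_trans[OF 1(1) Cons.IH] by simp
  qed simp
  show "r c + g c \<le> fst (foldl F p cs)" if "c \<in> set cs" "0 < r c"
    using that(1)
  proof (induction cs arbitrary: p)
    case (Cons c' cs)
    show ?case
    proof (cases "c = c'")
      case True
      show ?thesis unfolding foldl.simps True[symmetric] by (rule order_trans[OF 1(2)[OF that(2)] 2])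
    next
      case False
      then show ?thesis unfolding foldl.simps using Cons by (intro Cons.IH) simp
    qed
  qed simp
qed

lemma foldl_better_cases:
  "foldl (\<lambda>p c. better (r c) (g c) (j c) (y c) p) p cs = p \<or>
   (\<exists>c\<in>set cs. 0 < r c \<and>
     foldl (\<lambda>p c. better (r c) (g c) (j c) (y c) p) p cs = (r c + g c, j c, y c))"
proof (induction cs arbitrary: p)
  case (Cons c cs)
  show ?case using Cons[of "better (r c) (g c) (j c) (y c) p"]
    by (auto simp: better_def split: if_splits)
qed simp

locale allocation_instance =
  fixes n m :: nat and u :: "nat \<Rightarrow> nat \<Rightarrow> nat"
  assumes n_pos: "1 \<le> n" and m_pos: "1 \<le> m"
begin

definition W :: int where "W = (\<Sum>k\<in>{1..m}. \<Sum>i\<in>{1..n}. int (u i k))"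
definition L :: int where "L = 2 * W + 1"
definition Q :: int where "Q = (int m + 1) * L"
definition X :: int where "X = Q ^ length (pairs n)"
text \<open>Scanned states lie in \<open>{- X..<X}\<close> and weights have absolute value below
  \<open>X\<close>, so a lookup stays strictly between \<open>- 2 * X\<close> and
  \<open>2 * X\<close>. Rows \<open>4 * X\<close> apart therefore do not overlap.\<close>

definition S :: int where "S = 4 * X"

abbreviation agent :: "nat \<Rightarrow> nat" where "agent e \<equiv> fst (pairs n ! e)"
abbreviation rival :: "nat \<Rightarrow> nat" where "rival e \<equiv> snd (pairs n ! e)"

definition digit :: "nat \<Rightarrow> choice \<Rightarrow> nat \<Rightarrow> int" where
  "digit k c e = (if e \<in> set (snd c) then L else 0) +
     (if fst c = agent e then int (u (agent e) k)
      else if fst c = rival e \<and> e \<notin> set (snd c) then - int (u (agent e) k) else 0)"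

definition weight :: "nat \<Rightarrow> choice \<Rightarrow> int" where
  "weight k c = (\<Sum>e<length (pairs n). Q ^ e * digit k c e)"

definition accepting :: "int set" where
  "accepting = {x. \<exists>a. (\<forall>e<length (pairs n). a e \<in> {L..L + W}) \<and>
     x = (\<Sum>e<length (pairs n). Q ^ e * a e)}"

text \<open>The first component of \<open>dp k x\<close> is 1 plus the largest welfare from items \<open>1..k\<close> among
  the choices leading from \<open>x\<close> to an accepting number, and 0 if there are none.  The others
  are the back pointer: the agent receiving item \<open>k\<close> and the table address of the next state.\<close>

primrec dp :: "nat \<Rightarrow> int \<Rightarrow> int \<times> int \<times> int" where
  "dp 0 x = (if x \<in> accepting then 1 else 0, 0, 0)"
| "dp (Suc k) x = (if - X \<le> x \<and> x < X
     then foldl (\<lambda>p c. better (fst (dp k (x + weight (Suc k) c))) (int (u (fst c) (Suc k)))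
            (int (fst c)) (int k * S + (x + weight (Suc k) c)) p) (0, 0, 0) (choices n)
     else (0, 0, 0))"

lemma dp_step_ge:
  assumes "- X \<le> x" "x < X" "c \<in> set (choices n)" "0 < fst (dp k (x + weight (Suc k) c))"
  shows "fst (dp k (x + weight (Suc k) c)) + int (u (fst c) (Suc k)) \<le> fst (dp (Suc k) x)"
proof -
  let ?r = "\<lambda>c. fst (dp k (x + weight (Suc k) c))"
  let ?g = "\<lambda>c. int (u (fst c) (Suc k))"
  let ?j = "\<lambda>c :: choice. int (fst c)"
  let ?y = "\<lambda>c. int k * S + (x + weight (Suc k) c)"
  show ?thesis
    using foldl_better_ge(2)[of c "choices n" ?r ?g ?j ?y "(0, 0, 0)"] assms by simp
qed

lemma dp_step_cases:
  assumes "0 < fst (dp (Suc k) x)"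
  obtains c where "c \<in> set (choices n)" "0 < fst (dp k (x + weight (Suc k) c))"
    "dp (Suc k) x = (fst (dp k (x + weight (Suc k) c)) + int (u (fst c) (Suc k)), int (fst c),
       int k * S + (x + weight (Suc k) c))"
proof -
  let ?r = "\<lambda>c. fst (dp k (x + weight (Suc k) c))"
  let ?g = "\<lambda>c. int (u (fst c) (Suc k))"
  let ?j = "\<lambda>c :: choice. int (fst c)"
  let ?y = "\<lambda>c. int k * S + (x + weight (Suc k) c)"
  have x: "- X \<le> x \<and> x < X" using assms by (simp split: if_splits)
  have eq: "dp (Suc k) x = foldl (\<lambda>p c. better (?r c) (?g c) (?j c) (?y c) p) (0, 0, 0) (choices n)"
    using x by simp
  from foldl_better_cases[of ?r ?g ?j ?y "(0, 0, 0)" "choices n"]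
  show ?thesis using that assms unfolding eq by force
qed

text \<open>Here \<open>y k\<close> is the state before items \<open>1..k\<close> are assigned. Each
  step of the path is one of the candidates in the fold; the range condition is essential because
  \<open>dp\<close> is 0 outside the window.\<close>

lemma dp_path:
  assumes "\<And>k. k < l \<Longrightarrow> y k = y (Suc k) + weight (Suc k) (ch (Suc k))"
    and "\<And>k. k \<in> {1..l} \<Longrightarrow> ch k \<in> set (choices n)"
    and "\<And>k. k \<le> l \<Longrightarrow> - X \<le> y k \<and> y k < X" and "y 0 \<in> accepting"
  shows "1 + (\<Sum>k\<in>{1..l}. int (u (fst (ch k)) k)) \<le> fst (dp l (y l))"
  using assms(1-3)
proof (induction l)
  case 0
  then show ?case using assms(4) by simp
next
  case (Suc l)
  have eq: "y (Suc l) + weight (Suc l) (ch (Suc l)) = y l" using Suc.prems(1)[of l] by simp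
  have IH: "1 + (\<Sum>k\<in>{1..l}. int (u (fst (ch k)) k)) \<le> fst (dp l (y l))"
  proof (rule Suc.IH)
    show "y k = y (Suc k) + weight (Suc k) (ch (Suc k))" if "k < l" for k
      by (rule Suc.prems(1)) (use that in simp)
    show "ch k \<in> set (choices n)" if "k \<in> {1..l}" for k
      by (rule Suc.prems(2)) (use that in simp)
    show "- X \<le> y k \<and> y k < X" if "k \<le> l" for k
      by (rule Suc.prems(3)) (use that in simp)
  qed
  moreover have "0 \<le> (\<Sum>k\<in>{1..l}. int (u (fst (ch k)) k))" by (simp add: sum_nonneg)
  ultimately have "fst (dp l (y l)) + int (u (fst (ch (Suc l))) (Suc l)) \<le> fst (dp (Suc l) (y (Suc l)))"
    using dp_step_ge[of "y (Suc l)" "ch (Suc l)" l] Suc.prems(2,3) eq by simp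
  with IH show ?case by (simp del: dp.simps)
qed

section \<open>Ranges of digits, weights and partial sums\<close>

lemma value_le_W:
  assumes "K \<subseteq> {1..m}" "i \<in> {1..n}"
  shows "(\<Sum>k\<in>K. int (u i k)) \<le> W"
proof -
  have "(\<Sum>k\<in>K. int (u i k)) \<le> (\<Sum>k\<in>{1..m}. int (u i k))"
    by (rule sum_mono2) (use assms in auto)
  also have "\<dots> \<le> W"
    unfolding W_def by (rule sum_mono) (rule member_le_sum[of i], use assms in auto)
  finally show ?thesis .
qed

lemma W_nonneg: "0 \<le> W"
  by (simp add: W_def sum_nonneg)

lemma L_pos: "1 \<le> L"
  using W_nonneg by (simp add: L_def)

lemma Q_bounds: "2 * L \<le> Q" "L + W < Q" "int m * L + W < Q"
proof -
  have 1: "2 * L \<le> (int m + 1) * L" using m_pos L_pos by (intro mult_right_mono) auto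
  then show "2 * L \<le> Q" by (simp add: Q_def)
  then show "L + W < Q" using W_nonneg by (simp add: L_def)
  show "int m * L + W < Q" using W_nonneg by (simp add: Q_def L_def algebra_simps)
qed

lemma Q_pos: "1 \<le> Q"
  using Q_bounds L_pos by simp

lemma X_pos: "1 \<le> X"
  using Q_pos by (simp add: X_def)

lemma pair_agents:
  assumes "e < length (pairs n)"
  shows "agent e \<in> {1..n}" "rival e \<in> {1..n}" "agent e \<noteq> rival e"
  using nth_mem[OF assms] unfolding set_pairs by auto

lemma sum_digit:
  assumes "finite K" "e < length (pairs n)"
  shows "(\<Sum>k\<in>K. digit k (ch k) e) = L * int (card {k \<in> K. e \<in> set (snd (ch k))})
    + (\<Sum>k\<in>{k \<in> K. fst (ch k) = agent e}. int (u (agent e) k))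
    - (\<Sum>k\<in>{k \<in> K. fst (ch k) = rival e \<and> e \<notin> set (snd (ch k))}. int (u (agent e) k))"
proof -
  have "digit k (ch k) e = (if e \<in> set (snd (ch k)) then L else 0)
     + (if fst (ch k) = agent e then int (u (agent e) k) else 0)
     - (if fst (ch k) = rival e \<and> e \<notin> set (snd (ch k)) then int (u (agent e) k) else 0)" for k
    using pair_agents(3)[OF assms(2)] by (auto simp: digit_def)
  then show ?thesis
    using assms(1) by (simp add: sum.distrib sum_subtractf sum.inter_filter[symmetric])
qed

lemma sum_digit_bounds:
  assumes "K \<subseteq> {1..m}" "e < length (pairs n)"
  shows "- W \<le> (\<Sum>k\<in>K. digit k (ch k) e)" "(\<Sum>k\<in>K. digit k (ch k) e) \<le> int m * L + W"
proof -
  have fin: "finite K" using assms(1) finite_subset by blast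
  let ?M = "{k \<in> K. e \<in> set (snd (ch k))}"
  let ?A = "\<Sum>k\<in>{k \<in> K. fst (ch k) = agent e}. int (u (agent e) k)"
  let ?B = "\<Sum>k\<in>{k \<in> K. fst (ch k) = rival e \<and> e \<notin> set (snd (ch k))}. int (u (agent e) k)"
  have "card ?M \<le> card {1..m}" using assms(1) by (intro card_mono) auto
  then have "L * int (card ?M) \<le> L * int m" using L_pos by (intro mult_left_mono) auto
  moreover have "0 \<le> L * int (card ?M)" using L_pos by simp
  moreover have "0 \<le> ?A" "0 \<le> ?B" by (simp_all add: sum_nonneg)
  moreover have "?A \<le> W" "?B \<le> W"
    using assms(1) pair_agents(1)[OF assms(2)] by (intro value_le_W; auto)+
  ultimately show "- W \<le> (\<Sum>k\<in>K. digit k (ch k) e)" "(\<Sum>k\<in>K. digit k (ch k) e) \<le> int m * L + W"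
    unfolding sum_digit[OF fin assms(2)] by (auto simp: mult.commute)
qed

lemma sum_weight: "(\<Sum>k\<in>K. weight k (ch k)) = (\<Sum>e<length (pairs n). Q ^ e * (\<Sum>k\<in>K. digit k (ch k) e))"
  unfolding weight_def sum_distrib_left by (rule sum.swap)

text \<open>\<open>K\<close> is arbitrary so that the bound covers every partial sum: all states
  reached from 0 lie in the window of a row.\<close>

lemma sum_weight_bound:
  assumes "K \<subseteq> {1..m}"
  shows "\<bar>\<Sum>k\<in>K. weight k (ch k)\<bar> < X"
proof -
  have "\<bar>\<Sum>k\<in>K. digit k (ch k) e\<bar> < Q" if "e < length (pairs n)" for e
  proof -
    have "W < Q" using Q_bounds(2) L_pos by simp
    then show ?thesis using sum_digit_bounds[OF assms that, of ch] Q_bounds(3) by linarith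
  qed
  then show ?thesis
    unfolding sum_weight X_def using Q_pos by (rule digits_bound)
qed

lemma weight_bound:
  assumes "k \<in> {1..m}"
  shows "\<bar>weight k c\<bar> < X"
  using sum_weight_bound[of "{k}" "\<lambda>_. c"] assms by simp

lemma accepting_bound:
  assumes "x \<in> accepting"
  shows "\<bar>x\<bar> < X"
proof -
  obtain a where a: "\<And>e. e < length (pairs n) \<Longrightarrow> a e \<in> {L..L + W}"
    "x = (\<Sum>e<length (pairs n). Q ^ e * a e)"
    using assms by (auto simp: accepting_def)
  show ?thesis unfolding X_def a(2)
  proof (rule digits_bound)
    fix e assume "e < length (pairs n)"
    from a(1)[OF this] show "\<bar>a e\<bar> < Q" using Q_bounds(2) L_pos by simp
  qed (rule Q_pos)
qed

section \<open>Accepting numbers correspond to EF1 allocations\<close>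

definition bundles :: "(nat \<Rightarrow> choice) \<Rightarrow> nat \<Rightarrow> nat set" where
  "bundles ch i = {k \<in> {1..m}. fst (ch k) = i}"

abbreviation marked :: "(nat \<Rightarrow> choice) \<Rightarrow> nat \<Rightarrow> nat set" where
  "marked ch e \<equiv> {k \<in> {1..m}. e \<in> set (snd (ch k))}"

text \<open>A digit is \<open>L\<close> times the number of marks plus a difference between \<open>- W\<close> and \<open>W\<close>, and
  \<open>L > 2 * W\<close>, so it lies in \<open>{L..L + W}\<close> iff there is exactly one mark and the difference is
  nonnegative.\<close>

lemma accepting_iff:
  "(\<Sum>k\<in>{1..m}. weight k (ch k)) \<in> accepting \<longleftrightarrow>
   (\<forall>e<length (pairs n). card (marked ch e) = 1 \<and>
      bundle_value u (agent e) (bundles ch (rival e) - marked ch e)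
        \<le> bundle_value u (agent e) (bundles ch (agent e)))"
proof -
  let ?D = "\<lambda>e. \<Sum>k\<in>{1..m}. digit k (ch k) e"
  have "(\<Sum>k\<in>{1..m}. weight k (ch k)) \<in> accepting \<longleftrightarrow> (\<forall>e<length (pairs n). ?D e \<in> {L..L + W})"
  proof
    assume "(\<Sum>k\<in>{1..m}. weight k (ch k)) \<in> accepting"
    then obtain a where a: "\<And>e. e < length (pairs n) \<Longrightarrow> a e \<in> {L..L + W}"
      "(\<Sum>e<length (pairs n). Q ^ e * ?D e) = (\<Sum>e<length (pairs n). Q ^ e * a e)"
      unfolding accepting_def sum_weight by blast
    have D: "?D e = a e" if "e < length (pairs n)" for e
    proof (rule digits_unique[OF _ a(2) that])
      fix e assume e: "e < length (pairs n)"
      have "- W \<le> ?D e" "?D e \<le> int m * L + W" "L \<le> a e" "a e \<le> L + W"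
        using sum_digit_bounds[OF order.refl e, of ch] a(1)[OF e] by auto
      \<comment> \<open>\<open>a e - ?D e\<close> can be as large as
        \<open>L + 2 * W = 2 * L - 1\<close>, which is below \<open>Q\<close> because there is at
        least one item.\<close>
      moreover have "L \<le> int m * L" using m_pos L_pos by simp
      moreover have "Q = int m * L + L" by (simp add: Q_def algebra_simps)
      moreover have "L = 2 * W + 1" by (rule L_def)
      ultimately show "\<bar>?D e - a e\<bar> < Q"
        using W_nonneg unfolding abs_less_iff by linarith
    qed
    show "\<forall>e<length (pairs n). ?D e \<in> {L..L + W}"
    proof (intro allI impI)
      fix e assume e: "e < length (pairs n)"
      show "?D e \<in> {L..L + W}" unfolding D[OF e] by (rule a(1)[OF e])
    qed
  next
    assume "\<forall>e<length (pairs n). ?D e \<in> {L..L + W}"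
    then show "(\<Sum>k\<in>{1..m}. weight k (ch k)) \<in> accepting"
      unfolding accepting_def sum_weight mem_Collect_eq by (intro exI[of _ ?D] conjI refl)
  qed
  also have "\<dots> \<longleftrightarrow> (\<forall>e<length (pairs n). card (marked ch e) = 1 \<and>
      bundle_value u (agent e) (bundles ch (rival e) - marked ch e)
        \<le> bundle_value u (agent e) (bundles ch (agent e)))"
  proof (intro all_cong)
    fix e assume e: "e < length (pairs n)"
    define c where "c = card (marked ch e)"
    define a where "a = (\<Sum>k\<in>bundles ch (agent e). int (u (agent e) k))"
    define b where "b = (\<Sum>k\<in>bundles ch (rival e) - marked ch e. int (u (agent e) k))"
    have sets: "{k \<in> {1..m}. fst (ch k) = rival e \<and> e \<notin> set (snd (ch k))}
        = bundles ch (rival e) - marked ch e"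
      by (auto simp: bundles_def)
    have D: "?D e = L * int c + a - b"
      unfolding sum_digit[OF finite_atLeastAtMost e] sets a_def b_def c_def bundles_def ..
    have ab: "0 \<le> a" "0 \<le> b" "a \<le> W" "b \<le> W"
      unfolding a_def b_def using pair_agents(1)[OF e]
      by (auto intro!: value_le_W sum_nonneg simp: bundles_def)
    have "?D e \<in> {L..L + W} \<longleftrightarrow> c = 1 \<and> b \<le> a"
    proof (cases "c \<le> 1")
      case True
      then consider "c = 0" | "c = 1" by linarith
      then show ?thesis unfolding D using ab by cases (auto simp: L_def)
    next
      case False
      then have "L * 2 \<le> L * int c" using L_pos by (intro mult_left_mono) auto
      then show ?thesis unfolding D using ab False by (auto simp: L_def)
    qed
    also have "b \<le> a \<longleftrightarrow> bundle_value u (agent e) (bundles ch (rival e) - marked ch e)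
        \<le> bundle_value u (agent e) (bundles ch (agent e))"
      unfolding a_def b_def bundle_value_def by (simp flip: of_nat_sum)
    finally show "?D e \<in> {L..L + W} \<longleftrightarrow> card (marked ch e) = 1 \<and>
        bundle_value u (agent e) (bundles ch (rival e) - marked ch e)
        \<le> bundle_value u (agent e) (bundles ch (agent e))"
      by (simp only: c_def)
  qed
  finally show ?thesis .
qed

lemma EF1_of_accepting:
  assumes "(\<Sum>k\<in>{1..m}. weight k (ch k)) \<in> accepting"
  shows "EF1 {1..n} u (bundles ch)"
  unfolding EF1_def
proof (intro ballI)
  fix i j assume ij: "i \<in> {1..n}" "j \<in> {1..n}"
  show "\<exists>R\<subseteq>bundles ch j. finite R \<and> card R \<le> 1 \<and>
    bundle_value u i (bundles ch j - R) \<le> bundle_value u i (bundles ch i)"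
  proof (cases "i = j")
    case True
    then show ?thesis by (intro exI[of _ "{}"]) simp
  next
    case False
    then have "(i, j) \<in> set (pairs n)" using ij by (simp add: set_pairs)
    then obtain e where e: "e < length (pairs n)" "pairs n ! e = (i, j)"
      by (auto simp: in_set_conv_nth)
    have *: "card (marked ch e) = 1"
      "bundle_value u i (bundles ch j - marked ch e) \<le> bundle_value u i (bundles ch i)"
      using assms e unfolding accepting_iff by auto
    \<comment> \<open>The marked item may lie outside the bundle of \<open>j\<close>, hence the
      intersection.\<close>
    have "card (bundles ch j \<inter> marked ch e) \<le> card (marked ch e)"
      by (intro card_mono) auto
    moreover have "bundles ch j - bundles ch j \<inter> marked ch e = bundles ch j - marked ch e" by auto
    ultimately show ?thesis using *
      by (intro exI[of _ "bundles ch j \<inter> marked ch e"]) (auto simp: bundles_def)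
  qed
qed

lemma allocation_bundles:
  assumes "\<And>k. k \<in> {1..m} \<Longrightarrow> ch k \<in> set (choices n)"
  shows "allocation {1..n} {1..m} (bundles ch)"
  using choices_agent[OF assms] by (auto simp: allocation_def bundles_def)

lemma welfare_bundles:
  assumes "\<And>k. k \<in> {1..m} \<Longrightarrow> ch k \<in> set (choices n)"
  shows "utilitarian_welfare {1..n} u (bundles ch) = (\<Sum>k\<in>{1..m}. u (fst (ch k)) k)"
proof -
  have "(\<Sum>k\<in>{1..m}. u (fst (ch k)) k)
      = (\<Sum>i\<in>{1..n}. \<Sum>k\<in>{k \<in> {1..m}. fst (ch k) = i}. u (fst (ch k)) k)"
    by (rule sum.group[symmetric]) (use choices_agent[OF assms] in auto)
  also have "\<dots> = utilitarian_welfare {1..n} u (bundles ch)"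
    unfolding utilitarian_welfare_def bundle_value_def bundles_def
    by (intro sum.cong refl) auto
  finally show ?thesis by simp
qed

lemma choices_of_EF1:
  assumes al: "allocation {1..n} {1..m} q" and ef: "EF1 {1..n} u q"
  obtains ch where "\<And>k. k \<in> {1..m} \<Longrightarrow> ch k \<in> set (choices n)"
    "\<And>i. i \<in> {1..n} \<Longrightarrow> bundles ch i = q i" "(\<Sum>k\<in>{1..m}. weight k (ch k)) \<in> accepting"
proof -
  have sub: "q i \<subseteq> {1..m}" if "i \<in> {1..n}" for i using al that unfolding allocation_def by blast
  have "\<exists>r\<in>{1..m}. bundle_value u (agent e) (q (rival e) - {r}) \<le> bundle_value u (agent e) (q (agent e))"
    if e: "e < length (pairs n)" for e
  proof -
    note pa = pair_agents[OF e]
    from ef pa(1,2) obtain R where R: "R \<subseteq> q (rival e)" "finite R" "card R \<le> 1"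
      "bundle_value u (agent e) (q (rival e) - R) \<le> bundle_value u (agent e) (q (agent e))"
      unfolding EF1_def by blast
    \<comment> \<open>Exactly one mark per pair is required, so an empty \<open>R\<close> is
      replaced by an arbitrary item. Disregarding more can only lower the value of the rival's
      bundle.\<close>
    have "\<exists>r\<in>{1..m}. R \<subseteq> {r}"
    proof (cases "R = {}")
      case True
      then show ?thesis using m_pos by auto
    next
      case False
      then have "card R = 1" using R by (simp add: card_eq_0_iff le_Suc_eq)
      then obtain r where "R = {r}" by (auto simp: card_1_singleton_iff)
      then show ?thesis using R(1) sub[OF pa(2)] by auto
    qed
    then obtain r where r: "r \<in> {1..m}" "R \<subseteq> {r}" by blast
    have "bundle_value u (agent e) (q (rival e) - {r}) \<le> bundle_value u (agent e) (q (rival e) - R)"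
      using r sub[OF pa(2)] by (intro bundle_value_mono) (auto intro: finite_subset)
    then show ?thesis using r(1) R(4) by force
  qed
  then obtain r where r: "\<And>e. e < length (pairs n) \<Longrightarrow> r e \<in> {1..m}"
    "\<And>e. e < length (pairs n) \<Longrightarrow>
       bundle_value u (agent e) (q (rival e) - {r e}) \<le> bundle_value u (agent e) (q (agent e))"
    by metis
  have "\<exists>c\<in>set (choices n). k \<in> q (fst c) \<and>
      (\<forall>e<length (pairs n). e \<in> set (snd c) \<longleftrightarrow> r e = k)" if "k \<in> {1..m}" for k
  proof -
    have "k \<in> (\<Union>i\<in>{1..n}. q i)" using al that unfolding allocation_def by blast
    then obtain j where j: "j \<in> {1..n}" "k \<in> q j" by blast
    show ?thesis using choices_ex[OF j(1), of "\<lambda>e. r e = k"] j(2) by blast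
  qed
  then obtain ch where ch: "\<And>k. k \<in> {1..m} \<Longrightarrow> ch k \<in> set (choices n)"
    "\<And>k. k \<in> {1..m} \<Longrightarrow> k \<in> q (fst (ch k))"
    "\<And>k e. k \<in> {1..m} \<Longrightarrow> e < length (pairs n) \<Longrightarrow> e \<in> set (snd (ch k)) \<longleftrightarrow> r e = k"
    by metis
  have bq: "bundles ch i = q i" if i: "i \<in> {1..n}" for i
  proof -
    have "fst (ch k) = i" if "k \<in> q i" for k
    proof (rule ccontr)
      assume "fst (ch k) \<noteq> i"
      moreover have "k \<in> {1..m}" using sub[OF i] that by blast
      ultimately show False
        using al that i ch(2)[of k] choices_agent[OF ch(1)[of k]] unfolding allocation_def by blast
    qed
    then show ?thesis using sub[OF i] ch(2) by (auto simp: bundles_def)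
  qed
  have "marked ch e = {r e}" if "e < length (pairs n)" for e
    using ch(3) r(1) that by auto
  then have "(\<Sum>k\<in>{1..m}. weight k (ch k)) \<in> accepting"
    unfolding accepting_iff using r(2) bq pair_agents by simp
  with ch(1) bq show thesis by (rule that)
qed

text \<open>The states belonging to the given choices are suffix sums: \<open>y m = 0\<close> is the
  start, \<open>y 0\<close> is the total weight, and all of them lie in the window as partial
  sums.\<close>

lemma dp_complete:
  assumes "\<And>k. k \<in> {1..m} \<Longrightarrow> ch k \<in> set (choices n)"
    and "(\<Sum>k\<in>{1..m}. weight k (ch k)) \<in> accepting"
  shows "1 + (\<Sum>k\<in>{1..m}. int (u (fst (ch k)) k)) \<le> fst (dp m 0)"
proof -
  define y where "y k = (\<Sum>k'\<in>{Suc k..m}. weight k' (ch k'))" for k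
  have "1 + (\<Sum>k\<in>{1..m}. int (u (fst (ch k)) k)) \<le> fst (dp m (y m))"
  proof (rule dp_path)
    fix k assume "k < m"
    then have "{Suc k..m} = insert (Suc k) {Suc (Suc k)..m}" by auto
    then show "y k = y (Suc k) + weight (Suc k) (ch (Suc k))" by (simp add: y_def)
  next
    fix k assume "k \<le> m"
    have "\<bar>y k\<bar> < X" unfolding y_def by (rule sum_weight_bound) auto
    then show "- X \<le> y k \<and> y k < X" by linarith
  qed (use assms in \<open>auto simp: y_def\<close>)
  then show ?thesis by (simp add: y_def)
qed

text \<open>Round robin yields an EF1 allocation, whose choices form a path. This is what lets the
  traceback start.\<close>

lemma dp_feasible: "0 < fst (dp m 0)"
proof -
  obtain q where "allocation {1..n} {1..m} q" "EF1 {1..n} u q"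
    using EF1_allocation_exists[of "{1..m}" n u] n_pos by auto
  then obtain ch where "\<And>k. k \<in> {1..m} \<Longrightarrow> ch k \<in> set (choices n)"
    "(\<Sum>k\<in>{1..m}. weight k (ch k)) \<in> accepting"
    using choices_of_EF1 by metis
  from dp_complete[OF this] have "1 + (\<Sum>k\<in>{1..m}. int (u (fst (ch k)) k)) \<le> fst (dp m 0)" .
  moreover have "0 \<le> (\<Sum>k\<in>{1..m}. int (u (fst (ch k)) k))" by (simp add: sum_nonneg)
  ultimately show ?thesis by linarith
qed

lemma optimal_choices:
  assumes ch: "\<And>k. k \<in> {1..m} \<Longrightarrow> ch k \<in> set (choices n)"
    and acc: "(\<Sum>k\<in>{1..m}. weight k (ch k)) \<in> accepting"
    and opt: "fst (dp m 0) = 1 + (\<Sum>k\<in>{1..m}. int (u (fst (ch k)) k))"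
  shows "utilitarian_maximal_within_EF1 {1..n} {1..m} u (bundles ch)"
  unfolding utilitarian_maximal_within_EF1_def
proof (intro conjI allI impI allocation_bundles[OF ch] EF1_of_accepting[OF acc])
  fix q assume "allocation {1..n} {1..m} q \<and> EF1 {1..n} u q"
  then obtain ch' where ch': "\<And>k. k \<in> {1..m} \<Longrightarrow> ch' k \<in> set (choices n)"
    "\<And>i. i \<in> {1..n} \<Longrightarrow> bundles ch' i = q i" "(\<Sum>k\<in>{1..m}. weight k (ch' k)) \<in> accepting"
    using choices_of_EF1 by metis
  have "utilitarian_welfare {1..n} u q = utilitarian_welfare {1..n} u (bundles ch')"
    unfolding utilitarian_welfare_def using ch'(2) by simp
  moreover have "(\<Sum>k\<in>{1..m}. int (u (fst (ch' k)) k)) \<le> (\<Sum>k\<in>{1..m}. int (u (fst (ch k)) k))"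
    using dp_complete[OF ch'(1,3)] opt by simp
  ultimately show "utilitarian_welfare {1..n} u q \<le> utilitarian_welfare {1..n} u (bundles ch)"
    using welfare_bundles[OF ch] welfare_bundles[OF ch'(1)] by (simp flip: of_nat_sum)
qed

end

section \<open>The program\<close>

text \<open>Arrays \<open>0..n\<close> hold the input.  Entry \<open>e\<close> of \<open>Power\<close>, \<open>Mark\<close> and \<open>Val\<close> is \<open>Q ^ e\<close> times \<open>1\<close>, \<open>L\<close> and
  the value of the current item for the first agent of pair \<open>e\<close>, since the machine cannot multiply.
  \<open>Worth\<close> is \<open>W\<close>, \<open>Gap\<close> is \<open>L\<close>, and \<open>Level\<close> is the table address of number 0 in the current row.\<close>

datatype var = Table | Next | Agent | Worth | Gap | Item | Level | Pos | Index | Result | Stride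
  | Power | Mark | Val | Count | Save

definition arr :: "nat \<Rightarrow> var \<Rightarrow> nat" where
  "arr n v = n + (case v of Table \<Rightarrow> 1 | Next \<Rightarrow> 2 | Agent \<Rightarrow> 3 | Worth \<Rightarrow> 4 | Gap \<Rightarrow> 5 | Item \<Rightarrow> 6
     | Level \<Rightarrow> 7 | Pos \<Rightarrow> 8 | Index \<Rightarrow> 9 | Result \<Rightarrow> 10 | Stride \<Rightarrow> 11 | Power \<Rightarrow> 12 | Mark \<Rightarrow> 13
     | Val \<Rightarrow> 14 | Count \<Rightarrow> 15 | Save \<Rightarrow> 16)"

lemma arr_inject [simp]: "arr n v = arr n w \<longleftrightarrow> v = w"
  by (cases v; cases w) (simp_all add: arr_def)

lemma arr_not_input [simp]: "i \<le> n \<Longrightarrow> arr n v \<noteq> i" "i \<le> n \<Longrightarrow> i \<noteq> arr n v"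
  by (cases v; simp add: arr_def)+

lemma n_less_arr [simp]: "n < arr n v" "\<not> arr n v < n"
  by (cases v; simp add: arr_def)+

lemma arr_not_0 [simp]: "arr n v \<noteq> 0" "0 \<noteq> arr n v" "0 < arr n v"
  using arr_not_input[of 0 n v] by (simp_all add: neq0_conv[symmetric] del: neq0_conv)

abbreviation scalar :: "nat \<Rightarrow> var \<Rightarrow> expr" where
  "scalar n v \<equiv> Cell (arr n v) (Const 0)"

abbreviation entry :: "nat \<Rightarrow> var \<Rightarrow> nat \<Rightarrow> expr" where
  "entry n v e \<equiv> Cell (arr n v) (Const (int e))"

abbreviation assign :: "nat \<Rightarrow> var \<Rightarrow> expr \<Rightarrow> prog" where
  "assign n v e \<equiv> Store (arr n v) (Const 0) e"

abbreviation assign_entry :: "nat \<Rightarrow> var \<Rightarrow> nat \<Rightarrow> expr \<Rightarrow> prog" where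
  "assign_entry n v i e \<equiv> Store (arr n v) (Const (int i)) e"

abbreviation num_items :: expr where
  "num_items \<equiv> Cell 0 (Const 0)"

definition total_body :: "nat \<Rightarrow> prog" where
  "total_body n = Seq (assign n Item (Plus (scalar n Item) (Const 1)))
     (assign n Worth (Plus (scalar n Worth) (expr_sum (map (\<lambda>i. Cell i (scalar n Item)) [1..<Suc n]))))"

definition total_prog :: "nat \<Rightarrow> prog" where
  "total_prog n = Seq (While (Less (scalar n Item) num_items) (total_body n))
     (assign n Gap (Plus (Plus (scalar n Worth) (scalar n Worth)) (Const 1)))"

text \<open>Multiplying by \<open>Q\<close> in two stages, by \<open>L\<close> and then by
  \<open>m + 1\<close>, takes \<open>O(L + m)\<close> steps instead of \<open>O(Q)\<close>, and the
  intermediate product is exactly the entry of \<open>Mark\<close>.\<close>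

definition power_body :: "nat \<Rightarrow> nat \<Rightarrow> prog" where
  "power_body n e =
     Seq (product_prog (arr n Index) (arr n Result) (scalar n Gap) (entry n Power e))
    (Seq (assign_entry n Mark e (scalar n Result))
    (Seq (product_prog (arr n Index) (arr n Result) (Plus num_items (Const 1)) (entry n Mark e))
         (assign_entry n Power (Suc e) (scalar n Result))))"

definition power_prog :: "nat \<Rightarrow> prog" where
  "power_prog n = Seq (assign_entry n Power 0 (Const 1))
     (seqs (map (power_body n) [0..<length (pairs n)]))"

text \<open>The recursion generates nested loops, one per digit, the outermost for the top digit;
  each moves \<open>Pos\<close> through the digit values \<open>0..W\<close> above its start.
  \<open>Save\<close> and \<open>Count\<close> have one entry per depth, so inner loops leave the
  outer ones undisturbed.\<close>

fun accept_loops :: "nat \<Rightarrow> nat \<Rightarrow> prog" where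
  "accept_loops n 0 = Store (arr n Table) (scalar n Pos) (Const 1)"
| "accept_loops n (Suc e) =
     Seq (assign_entry n Save e (scalar n Pos))
    (Seq (assign_entry n Count e (Const 0))
    (Seq (While (Less (entry n Count e) (Plus (scalar n Worth) (Const 1)))
            (Seq (accept_loops n e)
            (Seq (assign_entry n Count e (Plus (entry n Count e) (Const 1)))
                 (assign n Pos (Plus (scalar n Pos) (entry n Power e))))))
         (assign n Pos (entry n Save e))))"

text \<open>\<open>Pos\<close> starts at the number all of whose digits are \<open>L\<close>, the
  least accepting one.\<close>

definition setup_prog :: "nat \<Rightarrow> prog" where
  "setup_prog n =
     Seq (assign n Stride (Plus (Plus (entry n Power (length (pairs n))) (entry n Power (length (pairs n))))
                           (Plus (entry n Power (length (pairs n))) (entry n Power (length (pairs n))))))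
    (Seq (assign n Item (Const 0))
         (assign n Pos (expr_sum (map (entry n Mark) [0..<length (pairs n)]))))"

text \<open>The case distinctions are decided when the program is generated; what remains in the
  program is a sum whose length depends on \<open>n\<close> only.\<close>

definition weight_expr :: "nat \<Rightarrow> choice \<Rightarrow> expr" where
  "weight_expr n c = expr_sum (map (\<lambda>e. Plus
       (if e \<in> set (snd c) then entry n Mark e else Const 0)
       (if fst c = fst (pairs n ! e) then entry n Val e
        else if fst c = snd (pairs n ! e) \<and> e \<notin> set (snd c) then Minus (Const 0) (entry n Val e)
        else Const 0)) [0..<length (pairs n)])"

text \<open>\<open>there\<close> needs no range check: outside the window of the previous row the
  memory is 0, which the first test rejects.\<close>

definition choice_prog :: "nat \<Rightarrow> choice \<Rightarrow> prog" where
  "choice_prog n c =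
    (let here = Plus (scalar n Level) (scalar n Pos);
         there = Plus (Minus (scalar n Level) (scalar n Stride)) (Plus (scalar n Pos) (weight_expr n c));
         reward = Plus (Cell (arr n Table) there) (Cell (fst c) (scalar n Item))
     in Cond (Conj (Less (Const 0) (Cell (arr n Table) there)) (Less (Cell (arr n Table) here) reward))
         (Seq (Store (arr n Table) here reward)
         (Seq (Store (arr n Agent) here (Const (int (fst c))))
              (Store (arr n Next) here there)))
         Skip)"

definition choices_prog :: "nat \<Rightarrow> prog" where
  "choices_prog n = seqs (map (choice_prog n) (choices n))"

definition val_body :: "nat \<Rightarrow> nat \<Rightarrow> prog" where
  "val_body n e =
     Seq (product_prog (arr n Index) (arr n Result) (Cell (fst (pairs n ! e)) (scalar n Item)) (entry n Power e))
         (assign_entry n Val e (scalar n Result))"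

definition row_prog :: "nat \<Rightarrow> prog" where
  "row_prog n = While (Less (scalar n Pos) (entry n Power (length (pairs n))))
     (Seq (choices_prog n) (assign n Pos (Plus (scalar n Pos) (Const 1))))"

definition level_prog :: "nat \<Rightarrow> prog" where
  "level_prog n = While (Less (scalar n Item) num_items)
    (Seq (assign n Item (Plus (scalar n Item) (Const 1)))
    (Seq (assign n Level (Plus (scalar n Level) (scalar n Stride)))
    (Seq (seqs (map (val_body n) [0..<length (pairs n)]))
    (Seq (assign n Pos (Minus (Const 0) (entry n Power (length (pairs n)))))
         (row_prog n)))))"

text \<open>\<open>Level\<close> is left at row \<open>m\<close>, so it is the address of state 0 in
  that row. Items are visited downwards, and the answer overwrites array 0 at positive indices
  only.\<close>

definition trace_prog :: "nat \<Rightarrow> prog" where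
  "trace_prog n = Seq (assign n Pos (scalar n Level))
     (While (Less (Const 0) (scalar n Item))
       (Seq (Store 0 (scalar n Item) (Cell (arr n Agent) (scalar n Pos)))
       (Seq (assign n Pos (Cell (arr n Next) (scalar n Pos)))
            (assign n Item (Minus (scalar n Item) (Const 1))))))"

text \<open>Without items a pair cannot receive its mark, so this case is caught first; the
  untouched memory then encodes the empty allocation.\<close>

definition EF1_prog :: "nat \<Rightarrow> prog" where
  "EF1_prog n = Cond (Less (Const 0) num_items)
     (Seq (total_prog n) (Seq (power_prog n) (Seq (setup_prog n)
       (Seq (accept_loops n (length (pairs n))) (Seq (level_prog n) (trace_prog n)))))) Skip"

lemma loop_free_choices_prog: "loop_free (choices_prog n)"
  by (auto simp: choices_prog_def choice_prog_def Let_def)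

context allocation_instance
begin

section \<open>Correctness and cost of the program\<close>

abbreviation array :: "memory \<Rightarrow> var \<Rightarrow> int \<Rightarrow> int" where
  "array s v \<equiv> s (arr n v)"

definition cell :: "memory \<Rightarrow> int \<Rightarrow> int \<times> int \<times> int" where
  "cell s y = (array s Table y, array s Agent y, array s Next y)"

definition has_input :: "memory \<Rightarrow> bool" where
  "has_input s \<longleftrightarrow> s 0 0 = int m \<and> (\<forall>i\<in>{1..n}. \<forall>k\<in>{1..m}. s i (int k) = int (u i k))"

lemma has_inputD: "has_input s \<Longrightarrow> i \<in> {1..n} \<Longrightarrow> k \<in> {1..m} \<Longrightarrow> s i (int k) = int (u i k)"
  by (simp add: has_input_def)

lemma has_input_update [simp]: "has_input (s(arr n v := f)) \<longleftrightarrow> has_input s"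
  by (simp add: has_input_def)

text \<open>The zeros of the initial memory double as a table of infeasible entries and as the start
  value of \<open>Level\<close>, so the phases before the table is filled have to preserve
  them.\<close>

definition blank :: "memory \<Rightarrow> bool" where
  "blank s \<longleftrightarrow> (\<forall>y. cell s y = (0, 0, 0)) \<and> array s Level 0 = 0"

definition has_total :: "memory \<Rightarrow> bool" where
  "has_total s \<longleftrightarrow> has_input s \<and> array s Worth 0 = W \<and> array s Gap 0 = L"

definition has_powers :: "memory \<Rightarrow> bool" where
  "has_powers s \<longleftrightarrow> has_total s \<and> (\<forall>e\<le>length (pairs n). array s Power (int e) = Q ^ e) \<and>
     (\<forall>e<length (pairs n). array s Mark (int e) = L * Q ^ e)"

lemma run_total_prog:
  "run (total_prog n) (input_memory n m u) (m * (6 + cost_bound (total_body n)) + 15)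
     (\<lambda>s. has_total s \<and> blank s)"
proof -
  let ?I = "\<lambda>k s. has_input s \<and> blank s \<and> array s Item 0 = int k \<and>
     array s Worth 0 = (\<Sum>k\<in>{1..k}. \<Sum>i\<in>{1..n}. int (u i k))"
  have init: "?I 0 (input_memory n m u)"
    by (auto simp: has_input_def blank_def cell_def input_memory_def arr_def split: var.splits)
  have body: "run (total_body n) s (cost_bound (total_body n)) (?I (Suc k))" if "k < m" "?I k s" for k s
  proof (rule run_loop_free)
    have "(\<Sum>i\<leftarrow>[1..<Suc n]. s i (int (Suc k))) = (\<Sum>i\<in>{1..n}. int (u i (Suc k)))"
    proof -
      have "(\<Sum>i\<leftarrow>[1..<Suc n]. s i (int (Suc k))) = (\<Sum>i\<in>{1..n}. s i (int (Suc k)))"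
        by (simp add: interv_sum_list_conv_sum_set_nat atLeastLessThanSuc_atLeastAtMost del: upt_Suc)
      also have "\<dots> = (\<Sum>i\<in>{1..n}. int (u i (Suc k)))"
        using that by (intro sum.cong refl has_inputD) auto
      finally show ?thesis .
    qed
    moreover have "(\<Sum>i\<leftarrow>[1..<Suc n]. (if i = arr n Item then f else s i) y) = (\<Sum>i\<leftarrow>[1..<Suc n]. s i y)" for f y
      by (intro arg_cong[where f = sum_list] map_cong refl) auto
    ultimately show "?I (Suc k) (result (total_body n) s)"
      using that(2)
      by (simp add: total_body_def blank_def cell_def o_def fun_upd_apply algebra_simps del: upt_Suc)
  qed (simp_all add: total_body_def)
  have "run (While (Less (scalar n Item) num_items) (total_body n)) (input_memory n m u)
     (m * (6 + cost_bound (total_body n)) + 6) (?I m)"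
  proof (rule run_While[where I = ?I and N = m and B = "cost_bound (total_body n)"])
    show "eval_test (Less (scalar n Item) num_items) s \<and>
        run (total_body n) s (cost_bound (total_body n)) (?I (Suc k))" if "k < m" "?I k s" for k s
      using body[OF that] that by (simp add: has_input_def)
  qed (use init in \<open>simp_all add: has_input_def add_mult_distrib2\<close>)
  then show ?thesis
    unfolding total_prog_def
  proof (rule run_Seq)
    show "run (assign n Gap (Plus (Plus (scalar n Worth) (scalar n Worth)) (Const 1))) s 9
      (\<lambda>s. has_total s \<and> blank s)" if "?I m s" for s
      using that by (intro run_loop_free) (simp_all add: has_total_def blank_def cell_def W_def L_def)
  qed simp
qed

lemma run_power_prog:
  assumes "has_total s" "blank s"
  shows "run (power_prog n) s (length (pairs n) * (60 * (nat L + m + 2)) + 4)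
     (\<lambda>s. has_powers s \<and> blank s)"
proof -
  let ?I = "\<lambda>e s. has_total s \<and> blank s \<and> (\<forall>e'\<le>e. array s Power (int e') = Q ^ e') \<and>
     (\<forall>e'<e. array s Mark (int e') = L * Q ^ e')"
  have body: "run (power_body n e) s (60 * (nat L + m + 2)) (?I (Suc e))" if I: "?I e s" for e s
  proof -
    have L: "array s Gap 0 = int (nat L)" using I L_pos by (simp add: has_total_def)
    have m: "s 0 0 = int m" using I by (simp add: has_total_def has_input_def)
    let ?s1 = "s(arr n Index := (array s Index)(0 := int (nat L)),
                 arr n Result := (array s Result)(0 := int (nat L) * Q ^ e))"
    let ?s2 = "?s1(arr n Mark := (array ?s1 Mark)(int e := L * Q ^ e))"
    let ?s3 = "?s2(arr n Index := (array ?s2 Index)(0 := int (m + 1)),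
                 arr n Result := (array ?s2 Result)(0 := int (m + 1) * (L * Q ^ e)))"
    have 1: "run (product_prog (arr n Index) (arr n Result) (scalar n Gap) (entry n Power e)) s
        ((nat L + 1) * 24) (\<lambda>s'. s' = ?s1)"
      by (rule run_product_prog) (use I L in auto)
    have 3: "run (product_prog (arr n Index) (arr n Result) (Plus num_items (Const 1)) (entry n Mark e)) ?s2
        ((m + 1 + 1) * 26) (\<lambda>s'. s' = ?s3)"
      by (rule run_product_prog) (use I m in auto)
    have 2: "run (assign_entry n Mark e (scalar n Result)) ?s1 4 (\<lambda>s'. s' = ?s2)"
      using L_pos by (intro run_loop_free) simp_all
    have "?I (Suc e) (result (assign_entry n Power (Suc e) (scalar n Result)) ?s3)"
      using I by (auto simp: has_total_def blank_def cell_def Q_def le_Suc_eq less_Suc_eq algebra_simps)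
    then have 4: "run (assign_entry n Power (Suc e) (scalar n Result)) ?s3 4 (?I (Suc e))"
      by (intro run_loop_free) simp_all
    show ?thesis
      unfolding power_body_def
      by (rule run_Seq[OF 1], simp only:, rule run_Seq[OF 2], simp only:, rule run_Seq[OF 3],
          simp only:, rule 4, rule order.refl, rule order.refl) simp
  qed
  show ?thesis
    unfolding power_prog_def
  proof (rule run_Seq[OF run_loop_free[where R = "?I 0" and T = 3]])
    show "run (seqs (map (power_body n) [0..<length (pairs n)])) s
      (length (pairs n) * (60 * (nat L + m + 2)) + 1) (\<lambda>s. has_powers s \<and> blank s)" if "?I 0 s" for s
      by (rule run_seqs_upt[where I = ?I and B = "60 * (nat L + m + 2)"])
        (use that body in \<open>auto simp: has_powers_def\<close>)
  qed (use assms in \<open>auto simp: has_total_def blank_def cell_def\<close>)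
qed

lemma run_setup_prog:
  assumes "has_powers s" "blank s"
  shows "run (setup_prog n) s (cost_bound (setup_prog n)) (\<lambda>s. has_powers s \<and> blank s \<and>
     array s Stride 0 = S \<and> array s Item 0 = 0 \<and> array s Pos 0 = (\<Sum>e<length (pairs n). L * Q ^ e))"
proof (rule run_loop_free)
  have "(\<Sum>e\<leftarrow>[0..<length (pairs n)]. array s Mark (int e)) = (\<Sum>e<length (pairs n). array s Mark (int e))"
    by (simp add: interv_sum_list_conv_sum_set_nat atLeast0LessThan)
  also have "\<dots> = (\<Sum>e<length (pairs n). L * Q ^ e)"
    using assms(1) by (simp add: has_powers_def)
  finally show "has_powers (result (setup_prog n) s) \<and> blank (result (setup_prog n) s) \<and>
     array (result (setup_prog n) s) Stride 0 = S \<and> array (result (setup_prog n) s) Item 0 = 0 \<and>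
     array (result (setup_prog n) s) Pos 0 = (\<Sum>e<length (pairs n). L * Q ^ e)"
    using assms by (simp add: setup_prog_def has_powers_def has_total_def blank_def cell_def S_def X_def o_def)
qed (simp_all add: setup_prog_def)

section \<open>Enumeration of the accepting numbers\<close>

definition box :: "nat \<Rightarrow> int set" where
  "box d = {x. \<exists>a. (\<forall>e<d. a e \<in> {0..W}) \<and> x = (\<Sum>e<d. Q ^ e * a e)}"

lemma box_0: "x \<in> box 0 \<longleftrightarrow> x = 0"
  by (simp add: box_def)

text \<open>Peeling off the top digit matches the outermost of the nested loops.\<close>

lemma box_Suc: "x \<in> box (Suc d) \<longleftrightarrow> (\<exists>v\<in>{0..W}. x - v * Q ^ d \<in> box d)"
proof
  assume "x \<in> box (Suc d)"
  then obtain a where a: "\<And>e. e < Suc d \<Longrightarrow> a e \<in> {0..W}" "x = (\<Sum>e<Suc d. Q ^ e * a e)"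
    unfolding box_def by blast
  have "x - a d * Q ^ d = (\<Sum>e<d. Q ^ e * a e)" unfolding a(2) by simp
  then have "x - a d * Q ^ d \<in> box d"
    unfolding box_def mem_Collect_eq by (intro exI[of _ a]) (use a(1) in simp)
  with a(1)[of d] show "\<exists>v\<in>{0..W}. x - v * Q ^ d \<in> box d" by blast
next
  assume "\<exists>v\<in>{0..W}. x - v * Q ^ d \<in> box d"
  then obtain v a where a: "v \<in> {0..W}" "\<And>e. e < d \<Longrightarrow> a e \<in> {0..W}"
    "x - v * Q ^ d = (\<Sum>e<d. Q ^ e * a e)"
    unfolding box_def by blast
  have "(\<Sum>e<Suc d. Q ^ e * (a(d := v)) e) = (\<Sum>e<d. Q ^ e * a e) + Q ^ d * v"
    by (simp add: sum.lessThan_Suc)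
  then have "x = (\<Sum>e<Suc d. Q ^ e * (a(d := v)) e)" using a(3) by (simp add: algebra_simps)
  moreover have "\<forall>e<Suc d. (a(d := v)) e \<in> {0..W}" using a(1,2) by (simp add: less_Suc_eq)
  ultimately show "x \<in> box (Suc d)" unfolding box_def by blast
qed

lemma accepting_box: "x \<in> accepting \<longleftrightarrow> x - (\<Sum>e<length (pairs n). L * Q ^ e) \<in> box (length (pairs n))"
proof
  assume "x \<in> accepting"
  then obtain a where a: "\<And>e. e < length (pairs n) \<Longrightarrow> a e \<in> {L..L + W}"
    "x = (\<Sum>e<length (pairs n). Q ^ e * a e)" unfolding accepting_def by blast
  have "x - (\<Sum>e<length (pairs n). L * Q ^ e) = (\<Sum>e<length (pairs n). Q ^ e * (a e - L))"
    unfolding a(2) sum_subtractf[symmetric] by (simp add: algebra_simps)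
  then show "x - (\<Sum>e<length (pairs n). L * Q ^ e) \<in> box (length (pairs n))"
    unfolding box_def mem_Collect_eq
    by (intro exI[of _ "\<lambda>e. a e - L"]) (use a(1) in force)
next
  assume "x - (\<Sum>e<length (pairs n). L * Q ^ e) \<in> box (length (pairs n))"
  then obtain a where a: "\<And>e. e < length (pairs n) \<Longrightarrow> a e \<in> {0..W}"
    "x - (\<Sum>e<length (pairs n). L * Q ^ e) = (\<Sum>e<length (pairs n). Q ^ e * a e)" unfolding box_def by blast
  have "x = (\<Sum>e<length (pairs n). Q ^ e * (a e + L))"
    using a(2) by (simp add: sum.distrib algebra_simps)
  then show "x \<in> accepting"
    unfolding accepting_def mem_Collect_eq
    by (intro exI[of _ "\<lambda>e. a e + L"]) (use a(1) in force)
qed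

abbreviation same_except :: "var set \<Rightarrow> memory \<Rightarrow> memory \<Rightarrow> bool" where
  "same_except A s s' \<equiv> (\<forall>a. a \<notin> arr n ` A \<longrightarrow> s' a = s a)"

lemma same_exceptD:
  assumes "same_except A s s'" "v \<notin> A"
  shows "array s' v = array s v"
proof -
  have "arr n v \<notin> arr n ` A" using assms(2) by (auto simp: image_iff)
  from assms(1)[rule_format, OF this] show ?thesis .
qed

lemma has_powers_cong:
  assumes "same_except A s s'" "A \<inter> {Worth, Gap, Power, Mark} = {}" "has_powers s"
  shows "has_powers s'"
proof -
  have "array s' v = array s v" if "v \<in> {Worth, Gap, Power, Mark}" for v
    using assms(1,2) that by (intro same_exceptD[of A]) auto
  moreover have "s' i = s i" if "i \<le> n" for i
  proof -
    have "i \<notin> arr n ` A" using that by (auto simp: image_iff)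
    from assms(1)[rule_format, OF this] show ?thesis .
  qed
  ultimately show ?thesis
    using assms(3) by (simp add: has_powers_def has_total_def has_input_def)
qed

text \<open>Restoring \<open>Pos\<close> and keeping \<open>Count\<close> and \<open>Save\<close>
  from index \<open>d\<close> on is what the enclosing loops rely on. The factor 4 is the cost of
  the innermost store.\<close>

lemma run_accept_loops:
  assumes "has_powers s" "d \<le> length (pairs n)"
  shows "run (accept_loops n d) s (4 * (11 * (nat W + 1)) ^ d)
     (\<lambda>s'. same_except {Table, Pos, Count, Save} s s' \<and> array s' Pos 0 = array s Pos 0 \<and>
        (\<forall>e\<ge>d. array s' Count (int e) = array s Count (int e) \<and> array s' Save (int e) = array s Save (int e)) \<and>
        array s' Table = (\<lambda>x. if x - array s Pos 0 \<in> box d then 1 else array s Table x))"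
  using assms
proof (induction d arbitrary: s)
  case 0
  show ?case
    by (rule run_loop_free) (auto simp: box_0 fun_eq_iff)
next
  case (Suc d)
  define p where "p = array s Pos 0"
  let ?B = "4 * (11 * (nat W + 1)) ^ d"
  let ?body = "Seq (accept_loops n d)
            (Seq (assign_entry n Count d (Plus (entry n Count d) (Const 1)))
                 (assign n Pos (Plus (scalar n Pos) (entry n Power d))))"
  let ?test = "Less (entry n Count d) (Plus (scalar n Worth) (Const 1))"
  let ?I = "\<lambda>i s'. same_except {Table, Pos, Count, Save} s s' \<and> array s' Pos 0 = p + int i * Q ^ d \<and>
     array s' Count (int d) = int i \<and> array s' Save (int d) = p \<and>
     (\<forall>e\<ge>Suc d. array s' Count (int e) = array s Count (int e) \<and> array s' Save (int e) = array s Save (int e)) \<and>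
     array s' Table = (\<lambda>x. if \<exists>v<i. x - p - int v * Q ^ d \<in> box d then 1 else array s Table x)"
  let ?R = "\<lambda>s'. same_except {Table, Pos, Count, Save} s s' \<and> array s' Pos 0 = array s Pos 0 \<and>
        (\<forall>e\<ge>Suc d. array s' Count (int e) = array s Count (int e) \<and> array s' Save (int e) = array s Save (int e)) \<and>
        array s' Table = (\<lambda>x. if x - array s Pos 0 \<in> box (Suc d) then 1 else array s Table x)"
  have body: "run ?body s' (?B + 13) (?I (Suc i))" if I: "?I i s'" for i s'
  proof -
    have hp: "has_powers s'"
      by (rule has_powers_cong[where A = "{Table, Pos, Count, Save}" and s = s]) (use I Suc.prems in auto)
    have pw: "array s Power (int d) = Q ^ d"
      using Suc.prems by (simp add: has_powers_def)
    show ?thesis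
    proof (rule run_Seq[OF Suc.IH[OF hp]])
      fix s''
      assume *: "same_except {Table, Pos, Count, Save} s' s'' \<and> array s'' Pos 0 = array s' Pos 0 \<and>
        (\<forall>e\<ge>d. array s'' Count (int e) = array s' Count (int e) \<and> array s'' Save (int e) = array s' Save (int e)) \<and>
        array s'' Table = (\<lambda>x. if x - array s' Pos 0 \<in> box d then 1 else array s' Table x)"
      have pw'': "array s'' Power (int d) = Q ^ d"
        using * I pw by auto
      have same: "same_except {Table, Pos, Count, Save} s s''" using * I by auto
      show "run (Seq (assign_entry n Count d (Plus (entry n Count d) (Const 1)))
                 (assign n Pos (Plus (scalar n Pos) (entry n Power d)))) s'' 13 (?I (Suc i))"
        by (rule run_loop_free)
          (use * I same in \<open>auto simp: fun_eq_iff pw'' algebra_simps less_Suc_eq\<close>)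
    qed (use Suc.prems in simp_all)
  qed
  have loop: "run (While ?test ?body) s' ((nat W + 1) * (?B + 21) + 8) (?I (nat W + 1))"
    if "?I 0 s'" for s'
  proof (rule run_While[where I = ?I and N = "nat W + 1" and B = "?B + 13"])
    have worth: "array s'' Worth 0 = W" if "?I i s''" for i s''
      using that Suc.prems(1) by (auto simp: has_powers_def has_total_def)
    show "eval_test ?test s'' \<and> run ?body s'' (?B + 13) (?I (Suc i))" if "i < nat W + 1" "?I i s''" for i s''
      using body[OF that(2)] worth[OF that(2)] that W_nonneg by auto
    show "\<not> eval_test ?test s'' \<and> ?I (nat W + 1) s''" if "?I (nat W + 1) s''" for s''
      using worth[OF that] that W_nonneg by auto
  qed (use that in \<open>simp_all add: algebra_simps\<close>)
  have final: "run (assign n Pos (entry n Save d)) s' 4 ?R" if "?I (nat W + 1) s'" for s'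
  proof (rule run_loop_free)
    have "(\<exists>v<nat W + 1. x - p - int v * Q ^ d \<in> box d) \<longleftrightarrow> x - p \<in> box (Suc d)" for x
    proof -
      have "(\<exists>v<nat W + 1. x - p - int v * Q ^ d \<in> box d) \<longleftrightarrow> (\<exists>v\<in>{0..W}. x - p - v * Q ^ d \<in> box d)"
      proof
        assume "\<exists>v<nat W + 1. x - p - int v * Q ^ d \<in> box d"
        then obtain v where "v < nat W + 1" "x - p - int v * Q ^ d \<in> box d" by blast
        then show "\<exists>v\<in>{0..W}. x - p - v * Q ^ d \<in> box d" using W_nonneg by (intro bexI[of _ "int v"]) auto
      next
        assume "\<exists>v\<in>{0..W}. x - p - v * Q ^ d \<in> box d"
        then obtain v where "v \<in> {0..W}" "x - p - v * Q ^ d \<in> box d" by blast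
        then show "\<exists>v<nat W + 1. x - p - int v * Q ^ d \<in> box d" by (intro exI[of _ "nat v"]) auto
      qed
      then show ?thesis by (simp only: box_Suc)
    qed
    then show "?R (result (assign n Pos (entry n Save d)) s')"
      using that by (auto simp: p_def)
  qed simp_all
  show ?case
    unfolding accept_loops.simps
  proof (rule run_Seq[OF run_loop_free[where T = 4 and R = "\<lambda>s'. s' = s(arr n Save := (array s Save)(int d := p))"]],
      simp, simp add: p_def, simp, simp only:,
      rule run_Seq[OF run_loop_free[where T = 3 and R = "?I 0"]])
    let ?s = "s(arr n Save := (array s Save)(int d := p))"
    show "?I 0 (result (assign_entry n Count d (Const 0)) ?s)"
      by (auto simp: p_def)
    show "run (Seq (While ?test ?body) (assign n Pos (entry n Save d))) s'
       ((nat W + 1) * (?B + 21) + 8 + 4) ?R" if "?I 0 s'" for s'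
      by (rule run_Seq[OF loop[OF that] final order.refl])
    \<comment> \<open>Since \<open>?B\<close> is at least 4, the overhead, at most 40 per iteration,
      is absorbed by \<open>10 * ?B\<close>. This is the origin of the factor 11.\<close>
    have "(1 :: nat) \<le> (11 * (nat W + 1)) ^ d" by simp
    then have "?B + 40 \<le> 11 * ?B" by simp
    then have "(nat W + 1) * (?B + 40) \<le> (nat W + 1) * (11 * ?B)" by (rule mult_le_mono2)
    then show "4 + (3 + ((nat W + 1) * (?B + 21) + 8 + 4)) \<le> 4 * (11 * (nat W + 1)) ^ Suc d"
      by (simp add: algebra_simps)
  qed simp_all
qed

section \<open>Filling one row of the table\<close>

lemma eval_weight_expr:
  assumes "\<And>e. e < length (pairs n) \<Longrightarrow> array s Mark (int e) = L * Q ^ e"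
    and "\<And>e. e < length (pairs n) \<Longrightarrow> array s Val (int e) = int (u (agent e) k) * Q ^ e"
  shows "eval_expr (weight_expr n c) s = weight k c"
proof -
  have "eval_expr (weight_expr n c) s = (\<Sum>e\<leftarrow>[0..<length (pairs n)]. Q ^ e * digit k c e)"
    unfolding weight_expr_def eval_expr_sum map_map
    by (intro arg_cong[where f = sum_list] map_cong refl)
      (use assms in \<open>auto simp: digit_def algebra_simps\<close>)
  also have "\<dots> = weight k c"
    by (simp add: weight_def interv_sum_list_conv_sum_set_nat atLeast0LessThan)
  finally show ?thesis .
qed

text \<open>All choices for one state act on a single entry. Treating its three components as one
  update turns the unrolled choices into the fold in \<open>dp\<close>.\<close>

definition set_cell :: "memory \<Rightarrow> int \<Rightarrow> int \<times> int \<times> int \<Rightarrow> memory" where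
  "set_cell s y p = s(arr n Table := (array s Table)(y := fst p),
     arr n Agent := (array s Agent)(y := fst (snd p)), arr n Next := (array s Next)(y := snd (snd p)))"

lemma cell_set_cell: "cell (set_cell s y p) z = (if z = y then p else cell s z)"
  by (simp add: cell_def set_cell_def)

lemma set_cell_cell: "set_cell s y (cell s y) = s"
  by (simp add: set_cell_def cell_def fun_eq_iff)

lemma eval_weight_expr_set_cell: "eval_expr (weight_expr n c) (set_cell s y p) = eval_expr (weight_expr n c) s"
  unfolding weight_expr_def eval_expr_sum map_map
  by (intro arg_cong[where f = sum_list] map_cong refl) (simp add: set_cell_def)

text \<open>The condition \<open>weight (Suc k) c \<noteq> S\<close> says that the entry being
  written is not the one being read, so the looked-up value is unaffected by earlier
  choices.\<close>

lemma result_choice_prog: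
  assumes c: "c \<in> set (choices n)" and s: "array s Stride 0 = S" "array s Level 0 = int (Suc k) * S"
    and x: "array s Pos 0 = x" and item: "s (fst c) (array s Item 0) = int (u (fst c) (Suc k))"
    and w: "eval_expr (weight_expr n c) s = weight (Suc k) c" and ne: "weight (Suc k) c \<noteq> S"
  shows "result (choice_prog n c) (set_cell s (int (Suc k) * S + x) p) =
    set_cell s (int (Suc k) * S + x)
      (better (array s Table (int k * S + (x + weight (Suc k) c))) (int (u (fst c) (Suc k))) (int (fst c))
         (int k * S + (x + weight (Suc k) c)) p)"
proof -
  let ?y = "int (Suc k) * S + x"
  let ?z = "int k * S + (x + weight (Suc k) c)"
  have yz: "?z \<noteq> ?y" "?y \<noteq> ?z" using ne by (auto simp: algebra_simps)
  define here where "here = Plus (scalar n Level) (scalar n Pos)"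
  define there where "there = Plus (Minus (scalar n Level) (scalar n Stride)) (Plus (scalar n Pos) (weight_expr n c))"
  define reward where "reward = Plus (Cell (arr n Table) there) (Cell (fst c) (scalar n Item))"
  have le: "fst c \<le> n" using choices_agent[OF c] by simp
  have ev: "eval_expr here (set_cell s ?y q) = ?y" "eval_expr there (set_cell s ?y q) = ?z"
    "eval_expr reward (set_cell s ?y q) = array s Table ?z + int (u (fst c) (Suc k))" for q
  proof -
    show "eval_expr here (set_cell s ?y q) = ?y"
      by (simp add: here_def set_cell_def s x)
    show there: "eval_expr there (set_cell s ?y q) = ?z"
      unfolding there_def eval_expr.simps eval_weight_expr_set_cell w
      by (simp add: set_cell_def s x algebra_simps)
    have "set_cell s ?y q (fst c) (array (set_cell s ?y q) Item 0) = int (u (fst c) (Suc k))"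
      using item le by (simp add: set_cell_def)
    moreover have "array (set_cell s ?y q) Table ?z = array s Table ?z"
      using yz by (simp add: set_cell_def)
    ultimately show "eval_expr reward (set_cell s ?y q) = array s Table ?z + int (u (fst c) (Suc k))"
      unfolding reward_def eval_expr.simps there by simp
  qed
  have tab: "array (set_cell s ?y q) Table ?z = array s Table ?z" "array (set_cell s ?y q) Table ?y = fst q" for q
    using yz by (simp_all add: set_cell_def)
  have st: "(set_cell s ?y q)(arr n Table := (array (set_cell s ?y q) Table)(?y := v)) = set_cell s ?y (v, snd q)"
    "(set_cell s ?y q)(arr n Agent := (array (set_cell s ?y q) Agent)(?y := v)) = set_cell s ?y (fst q, v, snd (snd q))"
    "(set_cell s ?y q)(arr n Next := (array (set_cell s ?y q) Next)(?y := v)) = set_cell s ?y (fst q, fst (snd q), v)"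
    for q v by (simp_all add: set_cell_def fun_eq_iff)
  have "choice_prog n c = Cond (Conj (Less (Const 0) (Cell (arr n Table) there)) (Less (Cell (arr n Table) here) reward))
         (Seq (Store (arr n Table) here reward)
         (Seq (Store (arr n Agent) here (Const (int (fst c))))
              (Store (arr n Next) here there))) Skip"
    unfolding choice_prog_def Let_def here_def there_def reward_def ..
  then show ?thesis
    by (simp only: result.simps eval_test.simps eval_expr.simps ev st tab better_def fst_conv snd_conv if_distrib
        split: if_split) auto
qed

text \<open>The window is twice as wide as the scanned range because lookups overshoot it; out there
  \<open>dp\<close> and the memory are both 0. These open windows are disjoint at stride
  \<open>4 * X\<close>, and the blank part contains the whole window of the next row.\<close>

definition table_upto :: "nat \<Rightarrow> memory \<Rightarrow> bool" where
  "table_upto k s \<longleftrightarrow>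
     (\<forall>k'\<le>k. \<forall>x. - 2 * X < x \<and> x < 2 * X \<longrightarrow> cell s (int k' * S + x) = dp k' x) \<and>
     (\<forall>y\<ge>int k * S + 2 * X. cell s y = (0, 0, 0))"

lemma run_row_prog:
  assumes hp: "has_powers s" and stride: "array s Stride 0 = S" and tab: "table_upto k s" and k: "k < m"
    and level: "array s Level 0 = int (Suc k) * S" and item: "array s Item 0 = int (Suc k)"
    and val: "\<And>e. e < length (pairs n) \<Longrightarrow> array s Val (int e) = int (u (agent e) (Suc k)) * Q ^ e"
    and pos: "array s Pos 0 = - X"
  shows "run (row_prog n) s (nat (2 * X) * (cost_bound (choices_prog n) + 12) + 6)
     (\<lambda>s'. same_except {Table, Agent, Next, Pos} s s' \<and> table_upto (Suc k) s')"
proof -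
  define y0 where "y0 = int (Suc k) * S"
  let ?I = "\<lambda>i s'. same_except {Table, Agent, Next, Pos} s s' \<and> array s' Pos 0 = - X + int i \<and>
    (\<forall>y. cell s' y = (if y0 - X \<le> y \<and> y < y0 - X + int i then dp (Suc k) (y - y0) else cell s y))"
  have X4: "S = 4 * X" by (rule S_def)
  have y0: "y0 = int k * S + 4 * X" by (simp add: y0_def X4 algebra_simps)
  have power: "array s Power (int (length (pairs n))) = X"
    using hp by (simp add: has_powers_def X_def)
  have body: "run (Seq (choices_prog n) (assign n Pos (Plus (scalar n Pos) (Const 1)))) s'
      (cost_bound (choices_prog n) + 6) (?I (Suc i))" if i: "i < nat (2 * X)" and I: "?I i s'" for i s'
  proof (rule run_loop_free)
    define x where "x = - X + int i"
    have x: "- X \<le> x" "x < X" using i by (auto simp: x_def)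
    have same: "same_except {Table, Agent, Next, Pos} s s'" using I by blast
    have empty: "cell s' (y0 + x) = (0, 0, 0)"
      using I tab x X_pos by (simp add: table_upto_def x_def y0)
    \<comment> \<open>The lookup address is below \<open>int k * S + 2 * X\<close>, while this pass
      writes only from \<open>y0 - X = int k * S + 3 * X\<close> on.\<close>
    have read: "array s' Table (int k * S + (x + weight (Suc k) c)) = fst (dp k (x + weight (Suc k) c))" for c
    proof -
      have w: "\<bar>weight (Suc k) c\<bar> < X" using weight_bound[of "Suc k" c] k by simp
      then have "- 2 * X < x + weight (Suc k) c" "x + weight (Suc k) c < 2 * X" using x by auto
      then have "cell s (int k * S + (x + weight (Suc k) c)) = dp k (x + weight (Suc k) c)"
        using tab by (simp add: table_upto_def)
      moreover have "cell s' (int k * S + (x + weight (Suc k) c)) = cell s (int k * S + (x + weight (Suc k) c))"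
        using I w x unfolding y0 by auto
      ultimately show ?thesis by (simp add: cell_def prod_eq_iff)
    qed
    have choice: "result (choice_prog n c) (set_cell s' (y0 + x) p) = set_cell s' (y0 + x)
        (better (fst (dp k (x + weight (Suc k) c))) (int (u (fst c) (Suc k))) (int (fst c))
          (int k * S + (x + weight (Suc k) c)) p)" if c: "c \<in> set (choices n)" for c p
      unfolding read[symmetric] y0_def
    proof (rule result_choice_prog[OF c])
      show "array s' Stride 0 = S" "array s' Level 0 = int (Suc k) * S"
        using same stride level by simp_all
      show "array s' Pos 0 = x" using I by (simp add: x_def)
      have le: "fst c \<in> {1..n}" by (rule choices_agent[OF c])
      then have "s' (fst c) = s (fst c)" "array s' Item = array s Item" using same by (simp_all add: image_iff)
      then show "s' (fst c) (array s' Item 0) = int (u (fst c) (Suc k))"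
        using item le k hp has_inputD[of s "fst c" "Suc k"] by (simp add: has_powers_def has_total_def)
      show "eval_expr (weight_expr n c) s' = weight (Suc k) c"
        by (rule eval_weight_expr) (use hp val same in \<open>simp_all add: has_powers_def\<close>)
      show "weight (Suc k) c \<noteq> S"
        using weight_bound[of "Suc k" c] k X_pos by (auto simp: X4)
    qed
    have fold: "result (seqs (map (choice_prog n) cs)) (set_cell s' (y0 + x) p) = set_cell s' (y0 + x)
        (foldl (\<lambda>p c. better (fst (dp k (x + weight (Suc k) c))) (int (u (fst c) (Suc k))) (int (fst c))
          (int k * S + (x + weight (Suc k) c)) p) p cs)" if "set cs \<subseteq> set (choices n)" for cs p
      using that by (induction cs arbitrary: p) (simp_all add: choice)
    \<comment> \<open>The entry is still the initial triple of the fold, so \<open>s'\<close> can be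
      rewritten as an update of itself.\<close>
    have "result (choices_prog n) s' = result (choices_prog n) (set_cell s' (y0 + x) (0, 0, 0))"
      using set_cell_cell[of s' "y0 + x"] unfolding empty by simp
    also have "\<dots> = set_cell s' (y0 + x) (dp (Suc k) x)"
      unfolding choices_prog_def fold[OF order.refl] using x by simp
    finally have res: "result (choices_prog n) s' = set_cell s' (y0 + x) (dp (Suc k) x)" .
    let ?s = "set_cell s' (y0 + x) (dp (Suc k) x)"
    let ?t = "result (assign n Pos (Plus (scalar n Pos) (Const 1))) ?s"
    have "same_except {Table, Agent, Next, Pos} s ?t"
      using same by (simp add: set_cell_def)
    moreover have "array ?t Pos 0 = - X + int (Suc i)"
      using I by (simp add: set_cell_def)
    moreover have "cell ?t y = cell ?s y" for y by (simp add: cell_def)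
    then have "cell ?t y = (if y0 - X \<le> y \<and> y < y0 - X + int (Suc i) then dp (Suc k) (y - y0) else cell s y)" for y
      using I unfolding cell_set_cell by (auto simp: x_def)
    ultimately have "?I (Suc i) ?t" by blast
    then show "?I (Suc i) (result (Seq (choices_prog n) (assign n Pos (Plus (scalar n Pos) (Const 1)))) s')"
      unfolding result.simps(3) res .
  qed (use loop_free_choices_prog in simp_all)
  show ?thesis
    unfolding row_prog_def
  proof (rule run_While[where I = ?I and N = "nat (2 * X)" and B = "cost_bound (choices_prog n) + 6"])
    show "?I 0 s" using pos by (auto simp del: dp.simps)
    have test: "eval_test (Less (scalar n Pos) (entry n Power (length (pairs n)))) s' \<longleftrightarrow> int i < 2 * X"
      if "?I i s'" for i s'
      using that power by auto
    show "eval_test (Less (scalar n Pos) (entry n Power (length (pairs n)))) s' \<and>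
      run (Seq (choices_prog n) (assign n Pos (Plus (scalar n Pos) (Const 1)))) s'
      (cost_bound (choices_prog n) + 6) (?I (Suc i))" if "i < nat (2 * X)" "?I i s'" for i s'
      using body[OF that] test[OF that(2)] that(1) by simp
    fix s' assume I: "?I (nat (2 * X)) s'"
    have c: "cell s' y = (if y0 - X \<le> y \<and> y < y0 + X then dp (Suc k) (y - y0) else cell s y)" for y
      using I X_pos by auto
    have "cell s' (int k' * S + x) = dp k' x" if "k' \<le> Suc k" "- 2 * X < x" "x < 2 * X" for k' x
    proof (cases "k' = Suc k")
      case True
      show ?thesis
      proof (cases "- X \<le> x \<and> x < X")
        case True
        then show ?thesis unfolding c \<open>k' = Suc k\<close> y0_def[symmetric] by simp
      next
        case False
        \<comment> \<open>Outside the scanned range \<open>dp\<close> is 0 by definition, and the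
          memory is still blank there.\<close>
        have "cell s (y0 + x) = (0, 0, 0)"
          using tab that X_pos by (simp add: table_upto_def y0)
        then show ?thesis using False unfolding c \<open>k' = Suc k\<close> y0_def[symmetric] by auto
      qed
    next
      case False
      then have "int k' * S \<le> int k * S" using that X_pos by (intro mult_right_mono) (auto simp: X4)
      then have "\<not> (y0 - X \<le> int k' * S + x)" using that X_pos y0 by linarith
      then have "cell s' (int k' * S + x) = cell s (int k' * S + x)" unfolding c by simp
      also have "\<dots> = dp k' x" using tab that False by (simp add: table_upto_def)
      finally show ?thesis .
    qed
    moreover have "cell s' y = (0, 0, 0)" if "y \<ge> y0 + 2 * X" for y
      using that X_pos tab unfolding c by (auto simp: table_upto_def y0)
    ultimately have "table_upto (Suc k) s'" unfolding table_upto_def y0_def by blast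
    then show "\<not> eval_test (Less (scalar n Pos) (entry n Power (length (pairs n)))) s' \<and>
      same_except {Table, Agent, Next, Pos} s s' \<and> table_upto (Suc k) s'"
      using I test[OF I] by simp
  qed (simp_all add: algebra_simps)
qed

lemma table_upto_cong:
  assumes "same_except A s s'" "A \<inter> {Table, Agent, Next} = {}" "table_upto k s"
  shows "table_upto k s'"
proof -
  have "array s' v = array s v" if "v \<in> {Table, Agent, Next}" for v
    using assms(1,2) that by (intro same_exceptD[of A]) auto
  then have "cell s' = cell s" by (simp add: cell_def fun_eq_iff)
  then show ?thesis using assms(3) by (simp add: table_upto_def)
qed

section \<open>All rows of the table, and the traceback\<close>

definition level_done :: "nat \<Rightarrow> memory \<Rightarrow> bool" where
  "level_done k s \<longleftrightarrow> has_powers s \<and> array s Stride 0 = S \<and> array s Item 0 = int k \<and>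
     array s Level 0 = int k * S \<and> table_upto k s"

lemma run_accept:
  assumes "has_powers s" "blank s" "array s Stride 0 = S" "array s Item 0 = 0"
    "array s Pos 0 = (\<Sum>e<length (pairs n). L * Q ^ e)"
  shows "run (accept_loops n (length (pairs n))) s (4 * (11 * (nat W + 1)) ^ length (pairs n)) (level_done 0)"
proof (rule run_mono[OF run_accept_loops[OF assms(1) order.refl] order.refl])
  fix s'
  assume *: "same_except {Table, Pos, Count, Save} s s' \<and> array s' Pos 0 = array s Pos 0 \<and>
      (\<forall>e\<ge>length (pairs n). array s' Count (int e) = array s Count (int e) \<and>
         array s' Save (int e) = array s Save (int e)) \<and>
      array s' Table = (\<lambda>x. if x - array s Pos 0 \<in> box (length (pairs n)) then 1 else array s Table x)"
  then have same: "same_except {Table, Pos, Count, Save} s s'" by blast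
  have "has_powers s'"
    by (rule has_powers_cong[OF same _ assms(1)]) simp
  moreover have "array s' v = array s v" if "v \<in> {Agent, Next, Level, Stride, Item}" for v
    by (rule same_exceptD[OF same]) (use that in auto)
  moreover have "array s' Table = (\<lambda>x. if x \<in> accepting then 1 else 0)"
    using * assms(2,5) by (simp add: accepting_box blank_def cell_def fun_eq_iff)
  ultimately have 1: "has_powers s' \<and> array s' Stride 0 = S \<and> array s' Item 0 = 0 \<and> array s' Level 0 = 0"
    and 2: "cell s' x = dp 0 x" for x
    using assms by (simp_all add: cell_def blank_def)
  have "dp 0 y = (0, 0, 0)" if "y \<ge> 2 * X" for y
    using accepting_bound[of y] that X_pos by auto
  then have "table_upto 0 s'" unfolding table_upto_def 2 by simp
  with 1 show "level_done 0 s'" by (simp add: level_done_def)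
qed

lemma run_level_body:
  assumes k: "k < m" and lev: "level_done k s"
  shows "run (Seq (assign n Item (Plus (scalar n Item) (Const 1)))
    (Seq (assign n Level (Plus (scalar n Level) (scalar n Stride)))
    (Seq (seqs (map (val_body n) [0..<length (pairs n)]))
    (Seq (assign n Pos (Minus (Const 0) (entry n Power (length (pairs n)))))
         (row_prog n))))) s
    (26 + length (pairs n) * (29 * (nat W + 1)) + nat (2 * X) * (cost_bound (choices_prog n) + 12))
    (level_done (Suc k))"
proof -
  let ?d = "length (pairs n)"
  let ?s1 = "s(arr n Item := (array s Item)(0 := int (Suc k)))"
  let ?s2 = "?s1(arr n Level := (array s Level)(0 := int (Suc k) * S))"
  have facts: "has_powers s" "array s Stride 0 = S" "array s Item 0 = int k"
     "array s Level 0 = int k * S" "table_upto k s"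
    using lev by (auto simp: level_done_def)
  have 1: "run (assign n Item (Plus (scalar n Item) (Const 1))) s 6 (\<lambda>s'. s' = ?s1)"
    by (rule run_loop_free) (simp_all add: facts add.commute)
  have 2: "run (assign n Level (Plus (scalar n Level) (scalar n Stride))) ?s1 7 (\<lambda>s'. s' = ?s2)"
    by (rule run_loop_free) (simp_all add: facts algebra_simps)
  have same2: "same_except {Item, Level} s ?s2" by simp
  have facts2: "has_powers ?s2" "array ?s2 Stride 0 = S" "array ?s2 Item 0 = int (Suc k)"
     "array ?s2 Level 0 = int (Suc k) * S" "table_upto k ?s2"
    by (rule has_powers_cong[OF same2 _ facts(1)], simp, simp add: facts, simp, simp,
        rule table_upto_cong[OF same2 _ facts(5)], simp)
  let ?J = "\<lambda>e s'. same_except {Index, Result, Val} ?s2 s' \<and>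
    (\<forall>e'<e. array s' Val (int e') = int (u (agent e') (Suc k)) * Q ^ e')"
  have val: "run (val_body n e) s' (29 * (nat W + 1)) (?J (Suc e))" if e: "e < ?d" and J: "?J e s'" for e s'
  proof -
    have same: "same_except {Index, Result, Val} ?s2 s'" using J by blast
    have hp: "has_powers s'" by (rule has_powers_cong[OF same _ facts2(1)]) simp
    have item: "array s' Item 0 = int (Suc k)"
      using same_exceptD[OF same, of Item] facts2(3) by simp
    note ag = pair_agents(1)[OF e]
    have ui: "s' (agent e) (int (Suc k)) = int (u (agent e) (Suc k))"
      using hp ag k by (intro has_inputD) (auto simp: has_powers_def has_total_def)
    have le: "int (u (agent e) (Suc k)) \<le> W"
      using value_le_W[of "{Suc k}" "agent e"] ag k by simp
    let ?t = "s'(arr n Index := (array s' Index)(0 := int (u (agent e) (Suc k))),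
        arr n Result := (array s' Result)(0 := int (u (agent e) (Suc k)) * Q ^ e))"
    have "run (product_prog (arr n Index) (arr n Result) (Cell (agent e) (scalar n Item)) (entry n Power e)) s'
        ((u (agent e) (Suc k) + 1) * 25) (\<lambda>t. t = ?t)"
      by (rule run_product_prog) (use ag ui item hp e in \<open>auto simp: has_powers_def\<close>)
    then have p: "run (product_prog (arr n Index) (arr n Result) (Cell (agent e) (scalar n Item)) (entry n Power e)) s'
        ((nat W + 1) * 25) (\<lambda>t. t = ?t)"
      by (rule run_mono) (use le in auto)
    have "run (assign_entry n Val e (scalar n Result)) ?t 4 (?J (Suc e))"
      by (rule run_loop_free) (use J in \<open>auto simp: less_Suc_eq\<close>)
    then show ?thesis
      unfolding val_body_def by (intro run_Seq[OF p]) auto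
  qed
  have 3: "run (seqs (map (val_body n) [0..<?d])) ?s2 (?d * (29 * (nat W + 1)) + 1) (?J ?d)"
    by (rule run_seqs_upt[where I = ?J and B = "29 * (nat W + 1)"]) (use val in auto)
  have 4: "run (Seq (assign n Pos (Minus (Const 0) (entry n Power ?d))) (row_prog n)) s3
     (6 + (nat (2 * X) * (cost_bound (choices_prog n) + 12) + 6)) (level_done (Suc k))" if J: "?J ?d s3" for s3
  proof -
    let ?s4 = "s3(arr n Pos := (array s3 Pos)(0 := - X))"
    have same: "same_except {Index, Result, Val, Pos} ?s2 ?s4" using J by simp
    have hp: "has_powers ?s4" by (rule has_powers_cong[OF same _ facts2(1)]) simp
    have tab: "table_upto k ?s4" by (rule table_upto_cong[OF same _ facts2(5)]) simp
    have rest: "array ?s4 Stride 0 = S" "array ?s4 Level 0 = int (Suc k) * S" "array ?s4 Item 0 = int (Suc k)"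
      using facts2(2-4) same_exceptD[OF same, of Stride] same_exceptD[OF same, of Level]
        same_exceptD[OF same, of Item] by simp_all
    have "array s3 Power (int ?d) = X" using hp by (simp add: has_powers_def X_def)
    then have pos: "run (assign n Pos (Minus (Const 0) (entry n Power ?d))) s3 6 (\<lambda>s'. s' = ?s4)"
      by (intro run_loop_free) simp_all
    have "run (row_prog n) ?s4 (nat (2 * X) * (cost_bound (choices_prog n) + 12) + 6)
        (\<lambda>s'. same_except {Table, Agent, Next, Pos} ?s4 s' \<and> table_upto (Suc k) s')"
      by (rule run_row_prog[OF hp rest(1) tab k rest(2,3)]) (use J in auto)
    then have row: "run (row_prog n) ?s4 (nat (2 * X) * (cost_bound (choices_prog n) + 12) + 6) (level_done (Suc k))"
    proof (rule run_mono[OF _ order.refl])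
      fix s' assume *: "same_except {Table, Agent, Next, Pos} ?s4 s' \<and> table_upto (Suc k) s'"
      then have same': "same_except {Table, Agent, Next, Pos} ?s4 s'" by blast
      have "has_powers s'" by (rule has_powers_cong[OF same' _ hp]) simp
      moreover have "array s' v = array ?s4 v" if "v \<in> {Stride, Level, Item}" for v
        by (rule same_exceptD[OF same']) (use that in auto)
      ultimately show "level_done (Suc k) s'"
        using * rest by (simp add: level_done_def)
    qed
    show ?thesis by (rule run_Seq[OF pos _ order.refl]) (simp only: row)
  qed
  show ?thesis
    by (rule run_Seq[OF 1], simp only:, rule run_Seq[OF 2], simp only:, rule run_Seq[OF 3 4], assumption,
        rule order.refl, rule order.refl) simp
qed

lemma run_level_prog:
  assumes "level_done 0 s"
  shows "run (level_prog n) s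
    (m * (32 + length (pairs n) * (29 * (nat W + 1)) + nat (2 * X) * (cost_bound (choices_prog n) + 12)) + 6)
    (level_done m)"
  unfolding level_prog_def
proof (rule run_While[where I = level_done and N = m
      and B = "26 + length (pairs n) * (29 * (nat W + 1)) + nat (2 * X) * (cost_bound (choices_prog n) + 12)"])
  have test: "eval_test (Less (scalar n Item) num_items) s \<longleftrightarrow> k < m" if "level_done k s" for k s
    using that by (simp add: level_done_def has_powers_def has_total_def has_input_def)
  show "eval_test (Less (scalar n Item) num_items) s \<and>
    run (Seq (assign n Item (Plus (scalar n Item) (Const 1)))
    (Seq (assign n Level (Plus (scalar n Level) (scalar n Stride)))
    (Seq (seqs (map (val_body n) [0..<length (pairs n)]))
    (Seq (assign n Pos (Minus (Const 0) (entry n Power (length (pairs n)))))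
         (row_prog n))))) s
    (26 + length (pairs n) * (29 * (nat W + 1)) + nat (2 * X) * (cost_bound (choices_prog n) + 12))
    (level_done (Suc k))" if "k < m" "level_done k s" for k s
    using run_level_body[OF that] test[OF that(2)] that(1) by blast
  show "\<not> eval_test (Less (scalar n Item) num_items) s \<and> level_done m s" if "level_done m s" for s
    using test[OF that] that by simp
qed (use assms in \<open>simp_all add: add_mult_distrib2\<close>)

text \<open>The memory records agents and addresses but no marks, so full choices exist only in the
  invariant \<open>traced\<close>: for a positive entry \<open>dp_step_cases\<close> supplies a
  choice that fits the stored agent and pointer. At the end the state is the total weight; its
  positive entry in row 0 makes it accepting, and the collected welfare equals the optimum.\<close>

lemma run_trace_prog:
  assumes lev: "level_done m s"
  shows "run (trace_prog n) s (m * 22 + 9)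
    (\<lambda>s'. utilitarian_maximal_within_EF1 {1..n} {1..m} u (output_allocation m s'))"
proof -
  let ?body = "Seq (Store 0 (scalar n Item) (Cell (arr n Agent) (scalar n Pos)))
       (Seq (assign n Pos (Cell (arr n Next) (scalar n Pos)))
            (assign n Item (Minus (scalar n Item) (Const 1))))"
  define traced where "traced k y ch s' \<longleftrightarrow>
     (\<forall>k'\<in>{Suc k..m}. ch k' \<in> set (choices n) \<and> s' 0 (int k') = int (fst (ch k'))) \<and>
     array s' Item 0 = int k \<and> array s' Pos 0 = int k * S + y \<and> y = (\<Sum>k'\<in>{Suc k..m}. weight k' (ch k')) \<and>
     0 < fst (dp k y) \<and> fst (dp m 0) = fst (dp k y) + (\<Sum>k'\<in>{Suc k..m}. int (u (fst (ch k')) k'))"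
    for k y ch and s' :: memory
  let ?I = "\<lambda>i s'. table_upto m s' \<and> (\<exists>y ch. traced (m - i) y ch s')"
  have body: "run ?body s' 17 (?I (Suc i))" if i: "i < m" and I: "?I i s'" for i s'
  proof (rule run_loop_free)
    obtain l where l: "m - i = Suc l" "l < m" "m - Suc i = l" using i by (metis Suc_diff_Suc diff_less_Suc less_Suc_eq_le Suc_le_eq)
    obtain y ch where tr: "traced (Suc l) y ch s'" using I unfolding l by blast
    have y: "\<bar>y\<bar> < X" using tr sum_weight_bound[of "{Suc (Suc l)..m}" ch] by (auto simp: traced_def)
    have "- 2 * X < y" "y < 2 * X" "Suc l \<le> m" using y l(2) by linarith+
    then have "cell s' (int (Suc l) * S + y) = dp (Suc l) y"
      using I unfolding table_upto_def by blast
    moreover obtain c where c: "c \<in> set (choices n)" "0 < fst (dp l (y + weight (Suc l) c))"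
      "dp (Suc l) y = (fst (dp l (y + weight (Suc l) c)) + int (u (fst c) (Suc l)), int (fst c),
         int l * S + (y + weight (Suc l) c))"
      using dp_step_cases[of l y] tr unfolding traced_def by blast
    ultimately have ptr: "array s' Agent (int (Suc l) * S + y) = int (fst c)"
      "array s' Next (int (Suc l) * S + y) = int l * S + (y + weight (Suc l) c)"
      by (simp_all add: cell_def)
    have at: "array s' Item 0 = int (Suc l)" "array s' Pos 0 = int (Suc l) * S + y"
      using tr by (auto simp: traced_def)
    define t where "t = s'(0 := (s' 0)(int (Suc l) := int (fst c)),
       arr n Pos := (array s' Pos)(0 := int l * S + (y + weight (Suc l) c)),
       arr n Item := (array s' Item)(0 := int l))"
    have res: "result ?body s' = t"
      unfolding result.simps eval_expr.simps t_def by (simp add: at ptr del: of_nat_Suc) simp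
    have "cell t = cell s'" by (simp add: t_def cell_def fun_eq_iff)
    then have "table_upto m t" using I by (simp add: table_upto_def)
    moreover have "traced l (y + weight (Suc l) c) (ch(Suc l := c)) t"
    proof -
      have ins: "{Suc l..m} = insert (Suc l) {Suc (Suc l)..m}" using l(2) by auto
      have "(\<Sum>k'\<in>{Suc l..m}. weight k' ((ch(Suc l := c)) k')) =
          weight (Suc l) c + (\<Sum>k'\<in>{Suc (Suc l)..m}. weight k' (ch k'))"
        unfolding ins by (subst sum.insert) (auto intro!: sum.cong)
      moreover have "(\<Sum>k'\<in>{Suc l..m}. int (u (fst ((ch(Suc l := c)) k')) k')) =
          int (u (fst c) (Suc l)) + (\<Sum>k'\<in>{Suc (Suc l)..m}. int (u (fst (ch k')) k'))"
        unfolding ins by (subst sum.insert) (auto intro!: sum.cong)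
      moreover have "\<forall>k'\<in>{Suc l..m}. (ch(Suc l := c)) k' \<in> set (choices n) \<and>
          t 0 (int k') = int (fst ((ch(Suc l := c)) k'))"
        unfolding ins using tr c(1) by (auto simp: traced_def t_def)
      moreover have "array t Item 0 = int l" "array t Pos 0 = int l * S + (y + weight (Suc l) c)"
        by (simp_all add: t_def)
      moreover have "fst (dp m 0) = fst (dp (Suc l) y) + (\<Sum>k'\<in>{Suc (Suc l)..m}. int (u (fst (ch k')) k'))"
        "y = (\<Sum>k'\<in>{Suc (Suc l)..m}. weight k' (ch k'))"
        using tr by (simp_all add: traced_def del: dp.simps)
      ultimately show ?thesis
        using c(2,3) unfolding traced_def by (simp del: dp.simps)
    qed
    ultimately show "?I (Suc i) (result ?body s')" unfolding res l(3) by blast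
  qed simp_all
  have init: "run (assign n Pos (scalar n Level)) s 4 (?I 0)"
  proof (rule run_loop_free)
    let ?t = "result (assign n Pos (scalar n Level)) s"
    have "cell ?t = cell s" by (simp add: cell_def fun_eq_iff)
    then have "table_upto m ?t" using lev by (simp add: table_upto_def level_done_def)
    moreover have "traced m 0 (\<lambda>_. undefined) ?t"
      using lev dp_feasible by (simp add: traced_def level_done_def)
    ultimately show "?I 0 ?t" unfolding diff_zero by blast
  qed simp_all
  have "run (While (Less (Const 0) (scalar n Item)) ?body) s' (m * 22 + 5)
     (\<lambda>s'. utilitarian_maximal_within_EF1 {1..n} {1..m} u (output_allocation m s'))" if "?I 0 s'" for s'
  proof (rule run_While[where I = ?I and N = m and B = 17])
    show "?I 0 s'" by (rule that)
    have test: "eval_test (Less (Const 0) (scalar n Item)) s'' \<longleftrightarrow> i < m" if "?I i s''" for i s''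
      using that by (auto simp: traced_def)
    show "eval_test (Less (Const 0) (scalar n Item)) s'' \<and> run ?body s'' 17 (?I (Suc i))"
      if "i < m" "?I i s''" for i s''
      using body[OF that] test[OF that(2)] that(1) by blast
    fix s'' assume I: "?I m s''"
    then obtain y ch where "traced 0 y ch s''" by auto
    then have ch: "\<And>k. k \<in> {1..m} \<Longrightarrow> ch k \<in> set (choices n)" "\<And>k. k \<in> {1..m} \<Longrightarrow> s'' 0 (int k) = int (fst (ch k))"
      and acc: "0 < fst (dp 0 (\<Sum>k\<in>{1..m}. weight k (ch k)))"
      and opt: "fst (dp m 0) = fst (dp 0 (\<Sum>k\<in>{1..m}. weight k (ch k))) + (\<Sum>k\<in>{1..m}. int (u (fst (ch k)) k))"
      by (auto simp: traced_def simp del: dp.simps)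
    have "(\<Sum>k\<in>{1..m}. weight k (ch k)) \<in> accepting" using acc by (simp split: if_splits)
    then have "utilitarian_maximal_within_EF1 {1..n} {1..m} u (bundles ch)"
      using opt by (intro optimal_choices ch(1)) simp_all
    moreover have "output_allocation m s'' = bundles ch"
      using ch(2) by (auto simp: output_allocation_def bundles_def fun_eq_iff)
    ultimately show "\<not> eval_test (Less (Const 0) (scalar n Item)) s'' \<and>
      utilitarian_maximal_within_EF1 {1..n} {1..m} u (output_allocation m s'')"
      using test[OF I] by simp
  qed simp
  then show ?thesis
    unfolding trace_prog_def by (rule run_Seq[OF init]) simp_all
qed

section \<open>Total running time\<close>

lemma run_EF1_prog:
  "run (EF1_prog n) (input_memory n m u)
     (m * (6 + cost_bound (total_body n)) +
      length (pairs n) * (60 * (nat L + m + 2)) +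
      4 * (11 * (nat W + 1)) ^ length (pairs n) +
      m * (32 + length (pairs n) * (29 * (nat W + 1)) + nat (2 * X) * (cost_bound (choices_prog n) + 12)) +
      m * 22 + (cost_bound (setup_prog n) + 39))
     (\<lambda>s. utilitarian_maximal_within_EF1 {1..n} {1..m} u (output_allocation m s))"
  (is "run _ _ ?T ?R")
proof -
  let ?main = "Seq (total_prog n) (Seq (power_prog n) (Seq (setup_prog n)
       (Seq (accept_loops n (length (pairs n))) (Seq (level_prog n) (trace_prog n)))))"
  \<comment> \<open>Five steps are reserved for the test on the number of items: 39 is
    \<open>15 + 4 + 6 + 9\<close> from the phases plus these 5.\<close>
  have "run ?main (input_memory n m u) (?T - 5) ?R"
    apply (rule run_Seq[OF run_total_prog])
     apply (rule run_Seq[OF run_power_prog])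
        apply (erule conjunct1)
       apply (erule conjunct2)
      apply (rule run_Seq[OF run_setup_prog])
         apply (erule conjunct1)
        apply (erule conjunct2)
       apply (rule run_Seq[OF run_accept])
            apply simp_all[5]
        apply (rule run_Seq[OF run_level_prog])
          apply assumption
         apply (rule run_trace_prog)
         apply assumption
        apply (rule order.refl)+
    apply simp
    done
  then obtain t s where t: "exec ?main (input_memory n m u) t s" "t \<le> ?T - 5" "?R s"
    unfolding run_def by blast
  have "eval_test (Less (Const 0) num_items) (input_memory n m u)"
    using m_pos by (simp add: input_memory_def)
  from exec.CondTrue[OF this t(1), of Skip]
  have "exec (EF1_prog n) (input_memory n m u) (5 + t) s"
    by (simp add: EF1_prog_def eval_nat_numeral)
  moreover have "5 + t \<le> ?T" using t(2) by simp
  ultimately show ?thesis using t(3) unfolding run_def by blast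
qed

end

text \<open>The cost bound of \<open>run_EF1_prog\<close> at \<open>m = 1\<close> with
  \<open>n\<close> in place of \<open>W\<close>, that is, with \<open>V = 1\<close> in the estimate
  \<open>W \<le> n * V\<close>.\<close>

definition time_const :: "nat \<Rightarrow> nat" where
  "time_const n = (6 + cost_bound (total_body n)) + length (pairs n) * (60 * (2 * n + 4)) +
     4 * (11 * (n + 1)) ^ length (pairs n) +
     (32 + length (pairs n) * (29 * (n + 1)) +
      2 * (2 * (2 * n + 1)) ^ length (pairs n) * (cost_bound (choices_prog n) + 12)) +
     22 + (cost_bound (setup_prog n) + 39)"

text \<open>Term by term: with \<open>m\<close> and \<open>V\<close> at least 1, each summand is at
  most its value at \<open>m = V = 1\<close> and \<open>w = n\<close>, times
  \<open>m * (m * V) ^ d\<close>.\<close>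

lemma time_bound:
  fixes w m V n d :: nat
  assumes w: "w \<le> n * V" and m: "1 \<le> m" and V: "1 \<le> V"
  shows "m * (6 + c1) + d * (60 * ((2 * w + 1) + m + 2)) + 4 * (11 * (w + 1)) ^ d +
      m * (32 + d * (29 * (w + 1)) + 2 * ((m + 1) * (2 * w + 1)) ^ d * c2) + m * 22 + c3
    \<le> ((6 + c1) + d * (60 * (2 * n + 4)) + 4 * (11 * (n + 1)) ^ d +
       (32 + d * (29 * (n + 1)) + 2 * (2 * (2 * n + 1)) ^ d * c2) + 22 + c3) * (m * (m * V) ^ d)"
proof -
  define P where "P = (m * V) ^ d"
  define B where "B = m * P"
  have mV: "1 \<le> m * V" using m V by simp
  then have P: "1 \<le> P" unfolding P_def by simp
  have mB: "m \<le> B" using P by (simp add: B_def)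
  then have B: "1 \<le> B" using m by simp
  have PB: "P \<le> B" using m by (simp add: B_def)
  have VmV: "V \<le> m * V" "m \<le> m * V" using m V by simp_all
  \<comment> \<open>Bounds linear in \<open>m * V\<close> occur only with the factor
    \<open>d\<close>. If \<open>d = 0\<close>, where \<open>P\<close> is just 1, they vanish;
    otherwise \<open>m * V \<le> P\<close>.\<close>
  have dP: "d * x \<le> d * (k * P)" if "x \<le> k * (m * V)" for x k
  proof (cases "d = 0")
    case False
    then have "m * V \<le> P" unfolding P_def using mV by (intro self_le_power) auto
    then show ?thesis using that by (intro mult_le_mono2) (meson le_trans mult_le_mono2)
  qed simp
  have w1: "w + 1 \<le> (n + 1) * V" "2 * w + 1 \<le> (2 * n + 1) * V" using w V by auto
  have w1': "w + 1 \<le> (n + 1) * (m * V)"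
    using w1(1) mult_le_mono2[OF VmV(1), of "n + 1"] by linarith
  have "60 * ((2 * w + 1) + m + 2) \<le> 60 * (2 * n + 4) * (m * V)"
  proof -
    have "2 * w + 1 \<le> (2 * n + 1) * (m * V)"
      using w1(2) mult_le_mono2[OF VmV(1), of "2 * n + 1"] by linarith
    moreover have "(2 * n + 4) * (m * V) = (2 * n + 1) * (m * V) + (m * V) + 2 * (m * V)" by (simp add: algebra_simps)
    ultimately have "(2 * w + 1) + m + 2 \<le> (2 * n + 4) * (m * V)" using VmV mV by linarith
    from mult_le_mono2[OF this, of 60] show ?thesis by (simp only: mult.assoc)
  qed
  from dP[OF this] have 2: "d * (60 * ((2 * w + 1) + m + 2)) \<le> d * (60 * (2 * n + 4)) * B"
    using mult_le_mono2[OF PB, of "d * (60 * (2 * n + 4))"] by (simp only: mult.assoc) 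
  have "(11 * (w + 1)) ^ d \<le> (11 * (n + 1) * (m * V)) ^ d"
  proof (rule power_mono)
    show "11 * (w + 1) \<le> 11 * (n + 1) * (m * V)"
      using mult_le_mono2[OF w1', of 11] by (simp only: mult.assoc)
  qed simp
  also have "\<dots> = (11 * (n + 1)) ^ d * P" unfolding P_def by (rule power_mult_distrib)
  also have "\<dots> \<le> (11 * (n + 1)) ^ d * B" using PB by (rule mult_le_mono2)
  finally have 3: "4 * (11 * (w + 1)) ^ d \<le> 4 * (11 * (n + 1)) ^ d * B" by simp
  have "29 * (w + 1) \<le> 29 * (n + 1) * (m * V)"
    using mult_le_mono2[OF w1', of 29] by (simp only: mult.assoc)
  from dP[OF this] have 41: "d * (29 * (w + 1)) \<le> d * (29 * (n + 1)) * P" by (simp only: mult.assoc)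
  have "((m + 1) * (2 * w + 1)) ^ d \<le> (2 * (2 * n + 1) * (m * V)) ^ d"
  proof (rule power_mono)
    have "(m + 1) * (2 * w + 1) \<le> (2 * m) * ((2 * n + 1) * V)" using m w1(2) by (intro mult_le_mono) auto
    then show "(m + 1) * (2 * w + 1) \<le> 2 * (2 * n + 1) * (m * V)" by (simp only: ac_simps)
  qed simp
  also have "\<dots> = (2 * (2 * n + 1)) ^ d * P" unfolding P_def by (rule power_mult_distrib)
  finally have "2 * ((m + 1) * (2 * w + 1)) ^ d * c2 \<le> 2 * ((2 * (2 * n + 1)) ^ d * P) * c2"
    by (intro mult_le_mono) auto
  also have "\<dots> = 2 * (2 * (2 * n + 1)) ^ d * c2 * P" by (simp only: ac_simps)
  finally have "32 + d * (29 * (w + 1)) + 2 * ((m + 1) * (2 * w + 1)) ^ d * c2 \<le>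
     (32 + d * (29 * (n + 1)) + 2 * (2 * (2 * n + 1)) ^ d * c2) * P"
    using 41 P unfolding add_mult_distrib[of _ _ P] by linarith
  from mult_le_mono2[OF this, of m]
  have 4: "m * (32 + d * (29 * (w + 1)) + 2 * ((m + 1) * (2 * w + 1)) ^ d * c2) \<le>
     (32 + d * (29 * (n + 1)) + 2 * (2 * (2 * n + 1)) ^ d * c2) * B"
    by (simp only: B_def mult.left_commute)
  have 1: "m * (6 + c1) \<le> (6 + c1) * B" "m * 22 \<le> 22 * B" "c3 \<le> c3 * B"
    using mB B by (simp_all add: mult.commute)
  show ?thesis
    using 1 2 3 4 unfolding P_def[symmetric] B_def[symmetric] add_mult_distrib[of _ _ B] by linarith
qed

theorem theorem7p5:
  fixes n :: nat
  assumes "n \<ge> 1"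
  shows "\<exists>(c :: prog) (C :: nat). \<forall>(m :: nat) (V :: nat) (u :: nat \<Rightarrow> nat \<Rightarrow> nat).
    (\<forall>i\<in>{1..n}. \<forall>k\<in>{1..m}. u i k > 0) \<longrightarrow>
    (\<forall>i\<in>{1..n}. bundle_value u i {1..m} \<le> V) \<longrightarrow>
    (\<exists>t s. exec c (input_memory n m u) t s \<and>
       utilitarian_maximal_within_EF1 {1..n} {1..m} u (output_allocation m s) \<and>
       (m \<ge> 1 \<longrightarrow>
          t \<le> C * (m ^ (n * (n - 1) + 1) * V ^ (n * (n - 1))) \<and>
          t \<le> C * (m ^ (n ^ 2) * V ^ (n ^ 2))))"
proof (rule exI[of _ "EF1_prog n"], rule exI[of _ "time_const n"], intro allI impI)
  fix m V :: nat and u :: "nat \<Rightarrow> nat \<Rightarrow> nat"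
  assume pos: "\<forall>i\<in>{1..n}. \<forall>k\<in>{1..m}. u i k > 0" and V: "\<forall>i\<in>{1..n}. bundle_value u i {1..m} \<le> V"
  show "\<exists>t s. exec (EF1_prog n) (input_memory n m u) t s \<and>
       utilitarian_maximal_within_EF1 {1..n} {1..m} u (output_allocation m s) \<and>
       (m \<ge> 1 \<longrightarrow>
          t \<le> time_const n * (m ^ (n * (n - 1) + 1) * V ^ (n * (n - 1))) \<and>
          t \<le> time_const n * (m ^ (n ^ 2) * V ^ (n ^ 2)))"
  proof (cases "m = 0")
    case True
    have "\<not> eval_test (Less (Const 0) num_items) (input_memory n m u)"
      by (simp add: input_memory_def True)
    from exec.CondFalse[OF this exec.Skip] obtain t where
      "exec (EF1_prog n) (input_memory n m u) t (input_memory n m u)"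
      unfolding EF1_prog_def by blast
    moreover have "utilitarian_maximal_within_EF1 {1..n} {1..m} u (output_allocation m (input_memory n m u))"
      by (auto simp: True utilitarian_maximal_within_EF1_def allocation_def output_allocation_def
          EF1_def utilitarian_welfare_def bundle_value_def)
    ultimately show ?thesis using True by auto
  next
    case False
    then interpret allocation_instance n m u
      using assms by unfold_locales auto
    let ?d = "n * (n - 1)"
    have W: "nat W \<le> n * V"
    proof -
      have "W = (\<Sum>i\<in>{1..n}. int (bundle_value u i {1..m}))"
        unfolding W_def bundle_value_def of_nat_sum by (rule sum.swap)
      also have "\<dots> \<le> (\<Sum>i\<in>{1..n}. int V)" using V by (intro sum_mono) auto
      finally show ?thesis by (simp add: nat_le_iff)
    qed
    \<comment> \<open>Positivity of the values enters here: with \<open>V = 0\<close> and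
      \<open>n \<ge> 2\<close> the claimed bound would be 0.\<close>
    have "1 \<le> u 1 1" using pos n_pos m_pos by (simp add: Suc_le_eq)
    also have "\<dots> \<le> bundle_value u 1 {1..m}"
      unfolding bundle_value_def by (rule member_le_sum) (use m_pos in auto)
    also have "\<dots> \<le> V" using V n_pos by auto
    finally have V_pos: "1 \<le> V" .
    have natL: "nat L = 2 * nat W + 1" using W_nonneg by (simp add: L_def nat_add_distrib nat_mult_distrib)
    have "2 * X = int (2 * ((m + 1) * (2 * nat W + 1)) ^ length (pairs n))"
      using W_nonneg by (simp add: X_def Q_def L_def algebra_simps)
    then have natX: "nat (2 * X) = 2 * ((m + 1) * (2 * nat W + 1)) ^ length (pairs n)"
      by (simp only: nat_int)
    obtain t s where t: "exec (EF1_prog n) (input_memory n m u) t s"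
      "utilitarian_maximal_within_EF1 {1..n} {1..m} u (output_allocation m s)"
      "t \<le> time_const n * (m * (m * V) ^ length (pairs n))"
      using run_EF1_prog time_bound[OF W m_pos V_pos, of "cost_bound (total_body n)" "length (pairs n)"
          "cost_bound (choices_prog n) + 12" "cost_bound (setup_prog n) + 39"]
      unfolding run_def time_const_def natL natX by (meson le_trans)
    have eq: "m * (m * V) ^ length (pairs n) = m ^ (?d + 1) * V ^ ?d"
      by (simp add: length_pairs power_mult_distrib)
    have "?d + 1 \<le> n ^ 2" "?d \<le> n ^ 2"
      using n_pos by (cases n; simp add: power2_eq_square)+
    then have "m ^ (?d + 1) * V ^ ?d \<le> m ^ (n ^ 2) * V ^ (n ^ 2)"
      using m_pos V_pos by (intro mult_le_mono power_increasing) auto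
    then have "t \<le> time_const n * (m ^ (n ^ 2) * V ^ (n ^ 2))"
      using t(3) unfolding eq by (meson le_trans mult_le_mono2)
    with t show ?thesis unfolding eq by blast
  qed
qed

end
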